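(* Let $O\mapsto\mathcal A(O)\subset B(\mathcal H)$ be a Haag--Kastler net of von Neumann algebras. The following are equivalent. (i) $\mathcal A$ satisfies essential duality, i.e. $[\mathcal A^d(O_1),\mathcal A^d(O_2)]=0$ for every spacelike pair $O_1\perp O_2$ of double cones. (ii) $O\mapsto\mathfrak{NS}_{\mathcal A}(O)$ is spacelike order-independent, i.e. $\Phi_1\circ\Phi_2=\Phi_2\circ\Phi_1$ for every spacelike pair $O_1\perp O_2$ and all $\Phi_i\in\mathfrak{NS}_{\mathcal A}(O_i)$, $i=1,2$. (iii) For every spacelike pair $O_1\perp O_2$, the unitary channels in $\mathfrak{NS}_{\mathcal A}(O_1)$ (those of the form $\operatorname{Ad}_u$ with $u\in B(\mathcal H)$ unitary) commute under composition with the unitary channels in $\mathfrak{NS}_{\mathcal A}(O_2)$.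
   Context: Net: $O\mapsto\mathcal A(O)\subset B(\mathcal H)$ assigns to each (bounded open) double cone $O$ in Minkowski space a von Neumann algebra on the Hilbert space $\mathcal H$, with isotony ($O_1\subset O_2\Rightarrow\mathcal A(O_1)\subset\mathcal A(O_2)$) and locality ($[\mathcal A(O_1),\mathcal A(O_2)]=0$ whenever $O_1\subset O_2'$, where $O'$ is the causal complement of $O$). One writes $O_1\perp O_2$ (spacelike pair) for $O_1\subset O_2'$. For a general open region $R$, $\mathcal A(R):=\bigvee_{V\subset R}\mathcal A(V)$, the von Neumann algebra generated by all $\mathcal A(V)$ with $V\subset R$ a double cone. The dual net is $\mathcal A^d(O):=\mathcal A(O')'$ (commutant). $\mathfrak{NS}_{\mathcal A}(O)$ is the class of normal unital completely positive maps $\Phi:B(\mathcal H)\to B(\mathcal H)$ with $\Phi(y)=y$ for all $y\in\mathcal A(O')$. $\operatorname{Ad}_u(x)=u^*xu$. *)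

theory Defs
  imports "HOL-Analysis.Analysis" "HOL-Library.Lub_Glb"
begin

section \<open>Complex Hilbert spaces\<close>

class scaleC =
  fixes scaleC :: "complex \<Rightarrow> 'a \<Rightarrow> 'a" (infixr \<open>*\<^sub>C\<close> 75)

class complex_vector = real_vector + scaleC +
  assumes scaleC_add_right: "c *\<^sub>C (x + y) = c *\<^sub>C x + c *\<^sub>C y"
    and scaleC_add_left: "(c + d) *\<^sub>C x = c *\<^sub>C x + d *\<^sub>C x"
    and scaleC_scaleC: "c *\<^sub>C d *\<^sub>C x = (c * d) *\<^sub>C x"
    and scaleR_scaleC: "r *\<^sub>R x = complex_of_real r *\<^sub>C x"

text \<open>
  The complex inner product is linear in its second argument. Its real part is the inner product
  of \<^class>\<open>real_inner\<close>; positive definiteness and the compatibility with norm and topology are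
  inherited from that class.
\<close>
class complex_hilbert_space = complex_vector + real_inner + complete_space +
  fixes cinner :: "'a \<Rightarrow> 'a \<Rightarrow> complex"
  assumes cinner_commute: "cinner x y = cnj (cinner y x)"
    and cinner_add_right: "cinner x (y + z) = cinner x y + cinner x z"
    and cinner_scaleC_right: "cinner x (c *\<^sub>C y) = c * cinner x y"
    and inner_eq_Re_cinner: "inner x y = Re (cinner x y)"

instantiation complex :: complex_hilbert_space
begin
definition scaleC_complex :: "complex \<Rightarrow> complex \<Rightarrow> complex" where
  "scaleC_complex c x = c * x"
definition cinner_complex :: "complex \<Rightarrow> complex \<Rightarrow> complex" where
  "cinner_complex x y = cnj x * y"
instance
  by standard
    (auto simp: scaleC_complex_def cinner_complex_def inner_complex_def scaleR_conv_of_real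
      algebra_simps)
end

lemma scaleC_one [simp]: "1 *\<^sub>C x = (x :: 'a::complex_vector)"
  using scaleR_scaleC[of 1 x] by simp

lemma scaleC_zero_right [simp]: "c *\<^sub>C (0 :: 'a::complex_vector) = 0"
  using scaleC_add_right[of c 0 0] by simp

lemma scaleC_minus_right: "c *\<^sub>C (- x) = - (c *\<^sub>C (x :: 'a::complex_vector))"
  using scaleC_add_right[of c x "- x"] by (simp add: eq_neg_iff_add_eq_0 add.commute)

lemma scaleC_diff_right: "c *\<^sub>C (x - y) = c *\<^sub>C x - c *\<^sub>C (y :: 'a::complex_vector)"
  using scaleC_add_right[of c x "- y"] by (simp add: scaleC_minus_right)

context complex_hilbert_space
begin

lemma cinner_add_left: "cinner (x + y) z = cinner x z + cinner y z"
  by (subst (1 2 3) cinner_commute) (simp add: cinner_add_right)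

lemma cinner_scaleC_left: "cinner (c *\<^sub>C x) y = cnj c * cinner x y"
  by (subst (1 2) cinner_commute) (simp add: cinner_scaleC_right)

lemma cinner_zero_right [simp]: "cinner x 0 = 0"
  using cinner_add_right[of x 0 0] by simp

lemma cinner_zero_left [simp]: "cinner 0 x = 0"
  using cinner_add_left[of 0 0 x] by simp

lemma cinner_minus_right: "cinner x (- y) = - cinner x y"
  by (rule group_add_class.minus_unique[symmetric]) (simp flip: cinner_add_right)

lemma cinner_minus_left: "cinner (- x) y = - cinner x y"
  by (rule group_add_class.minus_unique[symmetric]) (simp flip: cinner_add_left)

lemma cinner_diff_right: "cinner x (y - z) = cinner x y - cinner x z"
  using cinner_add_right[of x y "- z"] by (simp add: cinner_minus_right)

lemma cinner_diff_left: "cinner (x - y) z = cinner x z - cinner y z"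
  using cinner_add_left[of x "- y" z] by (simp add: cinner_minus_left)

lemma Im_cinner: "Im (cinner x y) = inner (\<i> *\<^sub>C x) y"
  by (simp add: inner_eq_Re_cinner cinner_scaleC_left)

lemma cinner_ext:
  assumes "\<And>z. cinner z x = cinner z y"
  shows "x = y"
proof -
  have "inner (x - y) (x - y) = 0"
    by (simp add: inner_eq_Re_cinner cinner_diff_right assms)
  then show ?thesis by simp
qed

end

lemma riesz_real:
  fixes l :: "'a::{real_inner, complete_space} \<Rightarrow> real"
  assumes "bounded_linear l"
  shows "\<exists>z. \<forall>x. inner z x = l x"
proof -
  interpret l: bounded_linear l by fact
  obtain K where K: "\<And>x. norm (l x) \<le> norm x * K" using l.bounded by blast
  define Q where "Q x = (norm x)\<^sup>2 - 2 * l x" for x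
  define m where "m = Inf (range Q)"
  have lower: "- (K\<^sup>2) \<le> Q x" for x
  proof -
    have "l x \<le> norm x * K" using K[of x] by simp
    moreover have "0 \<le> (norm x - K)\<^sup>2" by simp
    ultimately show ?thesis by (simp add: Q_def power2_diff)
  qed
  have bdd: "bdd_below (range Q)" by (rule bdd_belowI2[OF lower])
  have m_le: "m \<le> Q x" for x unfolding m_def by (rule cInf_lower[OF _ bdd]) simp
  have "\<exists>x. Q x < m + 1 / Suc n" for n
  proof -
    have "Inf (range Q) < m + 1 / Suc n" by (simp add: m_def)
    then show ?thesis using cInf_less_iff[OF _ bdd] by auto
  qed
  then obtain X where X: "\<And>n. Q (X n) < m + 1 / Suc n" by metis
  have par: "(norm (x - y))\<^sup>2 = 2 * Q x + 2 * Q y - 4 * Q ((1/2) *\<^sub>R (x + y))" for x y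
    unfolding Q_def power2_norm_eq_inner
    by (simp add: l.add l.scaleR inner_add_left inner_add_right inner_diff_left inner_diff_right
        inner_commute algebra_simps)
  have "Cauchy X"
  proof (rule metric_CauchyI)
    fix e :: real assume e: "0 < e"
    obtain N where N: "1 / real (Suc N) < e\<^sup>2 / 4"
      using e reals_Archimedean[of "e\<^sup>2 / 4"] by (auto simp: inverse_eq_divide)
    have "dist (X i) (X j) < e" if "i \<ge> N" "j \<ge> N" for i j
    proof -
      have a: "1 / real (Suc i) \<le> 1 / real (Suc N)" "1 / real (Suc j) \<le> 1 / real (Suc N)"
        using that by (auto intro!: divide_left_mono)
      have "(norm (X i - X j))\<^sup>2 < e\<^sup>2"
        using par[of "X i" "X j"] X[of i] X[of j] a N m_le[of "(1/2) *\<^sub>R (X i + X j)"] by linarith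
      then show ?thesis using e by (simp add: dist_norm power2_less_imp_less)
    qed
    then show "\<exists>M. \<forall>i\<ge>M. \<forall>j\<ge>M. dist (X i) (X j) < e" by blast
  qed
  then obtain z where z: "X \<longlonglongrightarrow> z" using Cauchy_convergent convergent_def by blast
  have "(\<lambda>n. Q (X n)) \<longlonglongrightarrow> Q z"
    unfolding Q_def by (intro tendsto_intros l.tendsto z)
  moreover have "(\<lambda>n. m + 1 / Suc n) \<longlonglongrightarrow> m + 0"
    by (intro tendsto_intros LIMSEQ_Suc lim_1_over_n)
  ultimately have "Q z \<le> m + 0"
    by (rule LIMSEQ_le) (use X less_imp_le in blast)
  then have min: "Q z \<le> Q x" for x using m_le[of x] by simp
  have ge: "0 \<le> 2 * t * (inner z h - l h) + t\<^sup>2 * (norm h)\<^sup>2" for t h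
    using min[of "z + t *\<^sub>R h"] unfolding Q_def power2_norm_eq_inner
    by (simp add: l.add l.scaleR inner_add_left inner_add_right inner_commute algebra_simps
        power2_eq_square)
  have "inner z h = l h" for h
  proof (rule ccontr)
    assume ne: "inner z h \<noteq> l h"
    define d where "d = inner z h - l h"
    define b where "b = (norm h)\<^sup>2 + 1"
    have b: "b > 0" "(norm h)\<^sup>2 < b" by (auto simp: b_def add_nonneg_pos)
    have d: "d\<^sup>2 > 0" using ne by (simp add: d_def)
    have "0 \<le> 2 * (- d / b) * d + (- d / b)\<^sup>2 * (norm h)\<^sup>2"
      using ge[of "- d / b" h] by (simp add: d_def)
    also have "\<dots> \<le> 2 * (- d / b) * d + (- d / b)\<^sup>2 * b"
      using b by (intro add_left_mono mult_left_mono) auto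
    also have "\<dots> = - d\<^sup>2 / b" using b by (simp add: field_simps power2_eq_square)
    also have "\<dots> < 0" using b d by simp
    finally show False by simp
  qed
  then show ?thesis by blast
qed


section \<open>The algebra of bounded operators\<close>

typedef (overloaded) 'h bop =
  "{f :: 'h::complex_hilbert_space \<Rightarrow> 'h. bounded_linear f \<and> (\<forall>c x. f (c *\<^sub>C x) = c *\<^sub>C f x)}"
  morphisms bop_apply Bop
  by (rule exI[of _ "\<lambda>_. 0"]) simp

setup_lifting type_definition_bop

lemma bounded_linear_bop_apply: "bounded_linear (bop_apply a)"
  using bop_apply[of a] by simp

lemma bop_apply_scaleC: "bop_apply a (c *\<^sub>C x) = c *\<^sub>C bop_apply a x"
  using bop_apply[of a] by simp

lemma bop_eqI: "(\<And>x. bop_apply a x = bop_apply b x) \<Longrightarrow> a = b"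
  by (simp add: bop_apply_inject[symmetric] fun_eq_iff)

lemma bop_apply_add: "bop_apply a (x + y) = bop_apply a x + bop_apply a y"
  using bounded_linear_bop_apply by (rule linear_add[OF bounded_linear.linear])

lemma bop_apply_zero [simp]: "bop_apply a 0 = 0"
  using bop_apply_add[of a 0 0] by simp

lemma bop_apply_diff: "bop_apply a (x - y) = bop_apply a x - bop_apply a y"
  using bounded_linear_bop_apply by (rule linear_diff[OF bounded_linear.linear])

text \<open>Multiplication is composition of operators.\<close>

instantiation bop :: (complex_hilbert_space) "{ring, monoid_mult}"
begin
lift_definition zero_bop :: "'a bop" is "\<lambda>_. 0" by simp
lift_definition one_bop :: "'a bop" is "\<lambda>x. x" by (simp add: bounded_linear_ident)
lift_definition plus_bop :: "'a bop \<Rightarrow> 'a bop \<Rightarrow> 'a bop" is "\<lambda>a b x. a x + b x"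
  by (simp add: bounded_linear_add scaleC_add_right)
lift_definition uminus_bop :: "'a bop \<Rightarrow> 'a bop" is "\<lambda>a x. - a x"
  by (simp add: bounded_linear_minus scaleC_minus_right)
lift_definition minus_bop :: "'a bop \<Rightarrow> 'a bop \<Rightarrow> 'a bop" is "\<lambda>a b x. a x - b x"
  by (simp add: bounded_linear_sub scaleC_diff_right)
lift_definition times_bop :: "'a bop \<Rightarrow> 'a bop \<Rightarrow> 'a bop" is "\<lambda>a b x. a (b x)"
  by (simp add: bounded_linear_compose)
instance
  by standard (transfer; simp add: fun_eq_iff linear_add bounded_linear.linear)+
end

instantiation bop :: (complex_hilbert_space) complex_vector
begin
lift_definition scaleC_bop :: "complex \<Rightarrow> 'a bop \<Rightarrow> 'a bop" is "\<lambda>c a x. c *\<^sub>C a x"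
proof -
  fix c and a :: "'a \<Rightarrow> 'a"
  assume a: "bounded_linear a \<and> (\<forall>d x. a (d *\<^sub>C x) = d *\<^sub>C a x)"
  have "bounded_linear (\<lambda>x. a (c *\<^sub>C x))"
  proof -
    have nrm: "norm (c *\<^sub>C x) = cmod c * norm x" for x :: 'a
    proof -
      have "(norm (c *\<^sub>C x))\<^sup>2 = Re (cnj c * c * cinner x x)"
        by (simp add: power2_norm_eq_inner inner_eq_Re_cinner cinner_scaleC_left
            cinner_scaleC_right mult.assoc mult.left_commute)
      also have "\<dots> = (cmod c)\<^sup>2 * inner x x"
        by (simp add: inner_eq_Re_cinner complex_norm_square[symmetric] mult.commute[of "cnj c"]
            flip: of_real_power)
      finally have "(norm (c *\<^sub>C x))\<^sup>2 = (cmod c * norm x)\<^sup>2"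
        by (simp add: power_mult_distrib power2_norm_eq_inner)
      then show ?thesis by (simp add: power2_eq_iff_nonneg)
    qed
    have "bounded_linear (\<lambda>x::'a. c *\<^sub>C x)"
      by (rule bounded_linear_intro[where K = "cmod c"])
        (simp_all add: scaleC_add_right scaleR_scaleC scaleC_scaleC nrm mult.commute)
    then show ?thesis using a bounded_linear_compose[of a] by blast
  qed
  then show "bounded_linear (\<lambda>x. c *\<^sub>C a x) \<and> (\<forall>d x. c *\<^sub>C a (d *\<^sub>C x) = d *\<^sub>C c *\<^sub>C a x)"
    using a by (simp add: scaleC_scaleC mult.commute)
qed
definition scaleR_bop :: "real \<Rightarrow> 'a bop \<Rightarrow> 'a bop" where
  "scaleR_bop r a = complex_of_real r *\<^sub>C a"
instance
proof
  fix a b :: "'a bop" and c d :: complex and r s :: real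
  show add_r: "c *\<^sub>C (a + b) = c *\<^sub>C a + c *\<^sub>C b" for c and a b :: "'a bop"
    by transfer (simp add: scaleC_add_right)
  show add_l: "(c + d) *\<^sub>C a = c *\<^sub>C a + d *\<^sub>C a" for c d and a :: "'a bop"
    by transfer (simp add: scaleC_add_left)
  show scale: "c *\<^sub>C d *\<^sub>C a = (c * d) *\<^sub>C a" for c d and a :: "'a bop"
    by transfer (simp add: scaleC_scaleC)
  have one: "1 *\<^sub>C a = a" for a :: "'a bop" by transfer simp
  show "r *\<^sub>R a = complex_of_real r *\<^sub>C a" by (simp add: scaleR_bop_def)
  show "r *\<^sub>R (a + b) = r *\<^sub>R a + r *\<^sub>R b" by (simp add: scaleR_bop_def add_r)
  show "(r + s) *\<^sub>R a = r *\<^sub>R a + s *\<^sub>R a" by (simp add: scaleR_bop_def add_l)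
  show "r *\<^sub>R s *\<^sub>R a = (r * s) *\<^sub>R a" by (simp add: scaleR_bop_def scale)
  show "1 *\<^sub>R a = a" by (simp add: scaleR_bop_def one)
qed
end

definition adj :: "'h::complex_hilbert_space bop \<Rightarrow> 'h bop" where
  "adj a = (THE b. \<forall>x y. cinner (bop_apply b x) y = cinner x (bop_apply a y))"

lemma adj_exists:
  fixes a :: "'h::complex_hilbert_space bop"
  shows "\<exists>b. \<forall>x y. cinner (bop_apply b x) y = cinner x (bop_apply a y)"
proof -
  interpret a: bounded_linear "bop_apply a" by (rule bounded_linear_bop_apply)
  have "\<exists>z. \<forall>y. inner z y = inner x (bop_apply a y)" for x
    by (rule riesz_real) (intro bounded_linear_inner_right_comp a.bounded_linear_axioms)
  then obtain B where B: "\<And>x y. inner (B x) y = inner x (bop_apply a y)" by metis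
  have inner_i: "inner (\<i> *\<^sub>C u) v = - inner u (\<i> *\<^sub>C v)" for u v :: 'h
    by (simp add: inner_eq_Re_cinner cinner_scaleC_left cinner_scaleC_right)
  have C: "cinner (B x) y = cinner x (bop_apply a y)" for x y
  proof (rule complex_eqI)
    show "Re (cinner (B x) y) = Re (cinner x (bop_apply a y))"
      using B by (simp add: inner_eq_Re_cinner)
    show "Im (cinner (B x) y) = Im (cinner x (bop_apply a y))"
      unfolding Im_cinner inner_i B bop_apply_scaleC by simp
  qed
  have uniq: "u = v" if "\<And>y. cinner u y = cinner v y" for u v :: 'h
    by (rule cinner_ext) (metis cinner_commute that)
  obtain K where K: "\<And>x. norm (bop_apply a x) \<le> norm x * K" "K \<ge> 0"
    using a.nonneg_bounded by blast
  have "bounded_linear B"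
  proof (rule bounded_linear_intro[where K = K])
    show "B (x + y) = B x + B y" for x y
      by (rule uniq) (simp add: C cinner_add_left)
    show "B (r *\<^sub>R x) = r *\<^sub>R B x" for r x
      by (rule uniq) (simp add: C scaleR_scaleC cinner_scaleC_left)
    show "norm (B x) \<le> norm x * K" for x
    proof (cases "norm (B x) = 0")
      case False
      have "norm (B x) * norm (B x) = inner x (bop_apply a (B x))"
        by (simp flip: B power2_eq_square add: power2_norm_eq_inner)
      also have "\<dots> \<le> norm x * norm (bop_apply a (B x))" by (rule norm_cauchy_schwarz)
      also have "\<dots> \<le> norm x * (norm (B x) * K)" by (rule mult_left_mono[OF K(1)]) simp
      finally have "norm (B x) * norm (B x) \<le> norm (B x) * (norm x * K)"
        by (simp add: mult_ac)
      then show ?thesis using False by (simp add: mult_le_cancel_left)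
    qed (use K in simp)
  qed
  moreover have "B (c *\<^sub>C x) = c *\<^sub>C B x" for c x
    by (rule uniq) (simp add: C cinner_scaleC_left)
  ultimately have "bop_apply (Bop B) = B" by (simp add: Bop_inverse)
  then show ?thesis using C by metis
qed

lemma cinner_adj: "cinner (bop_apply (adj a) x) y = cinner x (bop_apply a y)"
proof -
  have "\<exists>!b. \<forall>x y. cinner (bop_apply b x) y = cinner x (bop_apply a y)"
  proof (rule ex_ex1I[OF adj_exists])
    fix b c
    assume "\<forall>x y. cinner (bop_apply b x) y = cinner x (bop_apply a y)"
      and "\<forall>x y. cinner (bop_apply c x) y = cinner x (bop_apply a y)"
    then have "cinner z (bop_apply b x) = cinner z (bop_apply c x)" for x z
      by (metis cinner_commute)
    then show "b = c" by (metis bop_eqI cinner_ext)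
  qed
  from theI'[OF this] show ?thesis by (simp add: adj_def)
qed

text \<open>The order on operators is the Loewner order.\<close>

instantiation bop :: (complex_hilbert_space) order
begin
definition less_eq_bop :: "'a bop \<Rightarrow> 'a bop \<Rightarrow> bool" where
  "less_eq_bop a b \<longleftrightarrow> (\<forall>x. cinner x (bop_apply (b - a) x) \<in> \<real>\<^sub>\<ge>\<^sub>0)"
definition less_bop :: "'a bop \<Rightarrow> 'a bop \<Rightarrow> bool" where
  "less_bop a b \<longleftrightarrow> a \<le> b \<and> \<not> b \<le> a"
instance
proof
  fix a b c :: "'a bop"
  show "a < b \<longleftrightarrow> a \<le> b \<and> \<not> b \<le> a" by (rule less_bop_def)
  show "a \<le> a" by (simp add: less_eq_bop_def zero_bop.rep_eq)
  show "a \<le> c" if "a \<le> b" "b \<le> c"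
    unfolding less_eq_bop_def
  proof
    fix x
    have "cinner x (bop_apply (c - a) x)
        = cinner x (bop_apply (b - a) x) + cinner x (bop_apply (c - b) x)"
      by (simp add: minus_bop.rep_eq cinner_diff_right)
    then show "cinner x (bop_apply (c - a) x) \<in> \<real>\<^sub>\<ge>\<^sub>0"
      using that by (simp add: less_eq_bop_def nonneg_Reals_add_I)
  qed
  show "a = b" if "a \<le> b" "b \<le> a"
  proof -
    define q where "q x y = cinner x (bop_apply (b - a) y)" for x y
    have q_add: "q (x + x') y = q x y + q x' y" "q x (y + y') = q x y + q x y'" for x x' y y'
      by (simp_all add: q_def cinner_add_left cinner_add_right bop_apply_add)
    have q_scale: "q (c *\<^sub>C x) y = cnj c * q x y" "q x (c *\<^sub>C y) = c * q x y" for c x y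
      by (simp_all add: q_def cinner_scaleC_left cinner_scaleC_right bop_apply_scaleC)
    have q0: "q x x = 0" for x
    proof -
      have "cinner x (bop_apply (a - b) x) = - q x x"
        by (simp add: q_def minus_bop.rep_eq cinner_diff_right)
      then have "q x x \<in> \<real>\<^sub>\<ge>\<^sub>0" "- q x x \<in> \<real>\<^sub>\<ge>\<^sub>0"
        using that unfolding less_eq_bop_def q_def by metis+
      then show ?thesis by (simp add: complex_nonneg_Reals_iff complex_eq_iff)
    qed
    have "q x y = 0" for x y
    proof -
      have 1: "q x y + q y x = 0"
        using q_add(1)[of x y "x + y"] by (simp add: q_add(2) q0)
      have "\<i> * (q x y - q y x) = 0"
        using q_add(1)[of x "\<i> *\<^sub>C y" "x + \<i> *\<^sub>C y"]
        by (simp add: q_add(2) q_scale q0 right_diff_distrib)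
      then have "q x y = q y x" by simp
      with 1 show ?thesis by simp
    qed
    then have "cinner x (bop_apply b y) = cinner x (bop_apply a y)" for x y
      by (simp add: q_def minus_bop.rep_eq cinner_diff_right)
    then have "bop_apply a y = bop_apply b y" for y
      by (metis cinner_ext)
    then show ?thesis by (rule bop_eqI)
  qed
qed
end

definition unitary :: "'h::complex_hilbert_space bop \<Rightarrow> bool" where
  "unitary u \<longleftrightarrow> adj u * u = 1 \<and> u * adj u = 1"


section \<open>Von Neumann algebras\<close>

definition commutant :: "'h::complex_hilbert_space bop set \<Rightarrow> 'h bop set" where
  "commutant S = {a. \<forall>b\<in>S. a * b = b * a}"

text \<open>
  A self-adjoint set that equals its bicommutant is automatically a unital subalgebra.
\<close>
definition von_neumann_algebra :: "'h::complex_hilbert_space bop set \<Rightarrow> bool" where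
  "von_neumann_algebra M \<longleftrightarrow> (\<forall>a\<in>M. adj a \<in> M) \<and> commutant (commutant M) = M"

definition commuting_sets :: "'h::complex_hilbert_space bop set \<Rightarrow> 'h bop set \<Rightarrow> bool" where
  "commuting_sets S T \<longleftrightarrow> (\<forall>a\<in>S. \<forall>b\<in>T. a * b = b * a)"


section \<open>Channels\<close>

definition complex_linear_map ::
  "('h::complex_hilbert_space bop \<Rightarrow> 'h bop) \<Rightarrow> bool" where
  "complex_linear_map \<Phi> \<longleftrightarrow>
    (\<forall>a b. \<Phi> (a + b) = \<Phi> a + \<Phi> b) \<and> (\<forall>c a. \<Phi> (c *\<^sub>C a) = c *\<^sub>C \<Phi> a)"

text \<open>
  \<open>X\<close> represents the \<open>n \<times> n\<close> operator matrix with entries \<open>X i j\<close>, \<open>i, j < n\<close>, acting on the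
  \<open>n\<close>-fold direct sum of the Hilbert space.
\<close>
definition positive_matrix :: "nat \<Rightarrow> (nat \<Rightarrow> nat \<Rightarrow> 'h::complex_hilbert_space bop) \<Rightarrow> bool" where
  "positive_matrix n X \<longleftrightarrow>
    (\<forall>\<xi> :: nat \<Rightarrow> 'h. (\<Sum>i<n. \<Sum>j<n. cinner (\<xi> i) (bop_apply (X i j) (\<xi> j))) \<in> \<real>\<^sub>\<ge>\<^sub>0)"

definition completely_positive ::
  "('h::complex_hilbert_space bop \<Rightarrow> 'h bop) \<Rightarrow> bool" where
  "completely_positive \<Phi> \<longleftrightarrow>
    complex_linear_map \<Phi> \<and>
    (\<forall>n X. positive_matrix n X \<longrightarrow> positive_matrix n (\<lambda>i j. \<Phi> (X i j)))"

text \<open>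
  Normality of a positive map: suprema of bounded increasing nets of positive operators are
  preserved. Nets are replaced by upward directed sets.
\<close>
definition normal_map :: "('h::complex_hilbert_space bop \<Rightarrow> 'h bop) \<Rightarrow> bool" where
  "normal_map \<Phi> \<longleftrightarrow>
    (\<forall>D x. D \<noteq> {} \<and> (\<forall>a\<in>D. 0 \<le> a) \<and> (\<forall>a\<in>D. \<forall>b\<in>D. \<exists>c\<in>D. a \<le> c \<and> b \<le> c) \<and>
        isLub UNIV D x \<longrightarrow>
      isLub UNIV (\<Phi> ` D) (\<Phi> x))"

definition normal_ucp :: "('h::complex_hilbert_space bop \<Rightarrow> 'h bop) \<Rightarrow> bool" where
  "normal_ucp \<Phi> \<longleftrightarrow> completely_positive \<Phi> \<and> \<Phi> 1 = 1 \<and> normal_map \<Phi>"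

definition Ad :: "'h::complex_hilbert_space bop \<Rightarrow> 'h bop \<Rightarrow> 'h bop" where
  "Ad u x = adj u * x * u"


section \<open>Minkowski space\<close>

text \<open>
  A point of Minkowski space is a pair of its time coordinate and its space coordinates; the
  spatial dimension is an arbitrary positive number. Units are such that the speed of light is 1.
\<close>
type_synonym 's minkowski = "real \<times> 's"

definition chron_precedes :: "'s::euclidean_space minkowski \<Rightarrow> 's minkowski \<Rightarrow> bool" where
  "chron_precedes p q \<longleftrightarrow> norm (snd q - snd p) < fst q - fst p"

definition spacelike_sep :: "'s::euclidean_space minkowski \<Rightarrow> 's minkowski \<Rightarrow> bool" where
  "spacelike_sep p q \<longleftrightarrow> \<bar>fst p - fst q\<bar> < norm (snd p - snd q)"

definition is_double_cone :: "'s::euclidean_space minkowski set \<Rightarrow> bool" where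
  "is_double_cone K \<longleftrightarrow>
    (\<exists>p q. chron_precedes p q \<and> K = {x. chron_precedes p x \<and> chron_precedes x q})"

text \<open>
  For open \<open>R\<close> the strict inequality in \<^const>\<open>spacelike_sep\<close> may equivalently be replaced by the
  weak one. The causal complement need not be open, but only the double cones contained in it,
  hence in its interior, matter below.
\<close>
definition causal_complement :: "'s::euclidean_space minkowski set \<Rightarrow> 's minkowski set" where
  "causal_complement R = {x. \<forall>y\<in>R. spacelike_sep x y}"

definition spacelike_pair :: "'s::euclidean_space minkowski set \<Rightarrow> 's minkowski set \<Rightarrow> bool" where
  "spacelike_pair K L \<longleftrightarrow> is_double_cone K \<and> is_double_cone L \<and> K \<subseteq> causal_complement L"


section \<open>Nets of von Neumann algebras\<close>

text \<open>Only the values of a net on double cones are relevant.\<close>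
type_synonym ('s, 'h) net = "'s minkowski set \<Rightarrow> 'h bop set"

definition haag_kastler_net ::
  "('s::euclidean_space, 'h::complex_hilbert_space) net \<Rightarrow> bool" where
  "haag_kastler_net A \<longleftrightarrow>
    (\<forall>K. is_double_cone K \<longrightarrow> von_neumann_algebra (A K)) \<and>
    (\<forall>K L. is_double_cone K \<and> is_double_cone L \<and> K \<subseteq> L \<longrightarrow> A K \<subseteq> A L) \<and>
    (\<forall>K L. spacelike_pair K L \<longrightarrow> commuting_sets (A K) (A L))"

text \<open>The von Neumann algebra generated by a set is the smallest one containing it.\<close>
definition region_algebra ::
  "('s::euclidean_space, 'h::complex_hilbert_space) net \<Rightarrow> 's minkowski set \<Rightarrow> 'h bop set" where
  "region_algebra A R = von_neumann_algebra hull (\<Union>V \<in> {V. is_double_cone V \<and> V \<subseteq> R}. A V)"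

definition dual_net ::
  "('s::euclidean_space, 'h::complex_hilbert_space) net \<Rightarrow> ('s, 'h) net" where
  "dual_net A K = commutant (region_algebra A (causal_complement K))"

definition NS ::
  "('s::euclidean_space, 'h::complex_hilbert_space) net \<Rightarrow> 's minkowski set
    \<Rightarrow> ('h bop \<Rightarrow> 'h bop) set" where
  "NS A K = {\<Phi>. normal_ucp \<Phi> \<and> (\<forall>y \<in> region_algebra A (causal_complement K). \<Phi> y = y)}"

definition unitary_channels :: "('h::complex_hilbert_space bop \<Rightarrow> 'h bop) set" where
  "unitary_channels = {Ad u |u. unitary u}"

definition essential_duality ::
  "('s::euclidean_space, 'h::complex_hilbert_space) net \<Rightarrow> bool" where
  "essential_duality A \<longleftrightarrow>
    (\<forall>K\<^sub>1 K\<^sub>2. spacelike_pair K\<^sub>1 K\<^sub>2 \<longrightarrow> commuting_sets (dual_net A K\<^sub>1) (dual_net A K\<^sub>2))"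

definition spacelike_order_independent ::
  "('s::euclidean_space minkowski set
    \<Rightarrow> ('h::complex_hilbert_space bop \<Rightarrow> 'h bop) set) \<Rightarrow> bool" where
  "spacelike_order_independent \<N> \<longleftrightarrow>
    (\<forall>K\<^sub>1 K\<^sub>2. spacelike_pair K\<^sub>1 K\<^sub>2 \<longrightarrow>
      (\<forall>\<Phi>\<^sub>1 \<in> \<N> K\<^sub>1. \<forall>\<Phi>\<^sub>2 \<in> \<N> K\<^sub>2. \<Phi>\<^sub>1 \<circ> \<Phi>\<^sub>2 = \<Phi>\<^sub>2 \<circ> \<Phi>\<^sub>1))"

end

theory Submission
  imports Defs
begin

text \<open>
  Duality implies order independence: a channel \<open>\<Phi>\<close> that fixes an algebra \<open>N\<close> pointwise is an \<open>N\<close>-bimodule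
  map, so its Kraus operators lie in \<open>N'\<close>; if the Kraus operators of \<open>\<Phi>\<^sub>1\<close> belong to the algebra over
  which \<open>\<Phi>\<^sub>2\<close> is a bimodule map, then the two channels commute. Kraus' theorem is avoided: a
  Gram-Schmidt step splits off one Kraus operator at a time, and finitely many steps leave a
  remainder that vanishes on prescribed matrix entries and hence, by normality, is small at a
  prescribed vector.

  Commuting unitary channels imply duality: if \<open>Ad u\<close> and \<open>Ad v\<close> commute, then \<open>u v = c v u\<close> for a phase \<open>c\<close>.
  When the numerical range of \<open>u\<close> lies in a half plane away from \<open>0\<close>, this forces \<open>c = 1\<close>. Cayley
  transforms of small self-adjoint operators are such unitaries, and they determine these operators.
\<close>

text \<open>Two obstacles shape the proof. Stopping after finitely many steps avoids convergence
  questions for the remainders, but it controls the remainder \<open>R\<close> only through finitely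
  many expectation values. That settles \<open>R (\<Theta> x)\<close>, whereas in
  \<open>\<Theta> (R x)\<close> the map \<Theta> mixes all entries of \<open>R x\<close>. The remedy
  is an operator inequality: if \<open>p\<close> projects onto the span of a finite orthonormal set
  and the effect \<open>R p\<close> vanishes on that set, then \<open>R p \<le> 1 - p\<close>, and
  normality of \<Theta> takes over. The other part \<open>R (1 - p)\<close> inherits its smallness
  from \<open>\<Phi> (1 - p)\<close>. Finite subsets of a complete orthonormal set, directed by
  inclusion, replace sequences because the Hilbert space may be nonseparable. In the converse
  direction the phase is a genuine obstruction: two anticommuting Pauli matrices induce commuting
  channels. Commutation of two arbitrary unitaries can therefore not be read off from their
  channels, and special unitaries have to be chosen.\<close>

section \<open>Complex inner products and positive quadratic polynomials\<close>

lemma cinner_self: "cinner x x = complex_of_real ((norm x)\<^sup>2)" for x :: "'a::complex_hilbert_space"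
proof (rule complex_eqI)
  have "Im (cinner x x) = Im (cnj (cinner x x))" using cinner_commute[of x x] by simp
  then show "Im (cinner x x) = Im (complex_of_real ((norm x)\<^sup>2))" by simp
qed (simp add: power2_norm_eq_inner inner_eq_Re_cinner)

lemma norm_scaleC: "norm (c *\<^sub>C x) = cmod c * norm x" for x :: "'a::complex_hilbert_space"
proof -
  have "cinner (c *\<^sub>C x) (c *\<^sub>C x) = (c * cnj c) * cinner x x"
    by (simp add: cinner_scaleC_left cinner_scaleC_right mult_ac)
  then have "complex_of_real ((norm (c *\<^sub>C x))\<^sup>2) = complex_of_real ((cmod c * norm x)\<^sup>2)"
    by (simp only: cinner_self complex_norm_square[symmetric] power_mult_distrib of_real_mult)
  then have "(norm (c *\<^sub>C x))\<^sup>2 = (cmod c * norm x)\<^sup>2" by (simp only: of_real_eq_iff)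
  then show ?thesis by (simp add: power2_eq_iff_nonneg)
qed

lemma cinner_sum_right: "cinner x (sum f I) = (\<Sum>i\<in>I. cinner x (f i))"
  by (induction I rule: infinite_finite_induct) (simp_all add: cinner_add_right)

lemma cinner_sum_left: "cinner (sum f I) x = (\<Sum>i\<in>I. cinner (f i) x)"
  by (induction I rule: infinite_finite_induct) (simp_all add: cinner_add_left)

lemma cmod_cinner_le: "cmod (cinner x y) \<le> norm x * norm y"
  for x y :: "'a::complex_hilbert_space"
proof (cases "cinner x y = 0")
  case False
  define c where "c = cnj (cinner x y) / cmod (cinner x y)"
  have c: "cmod c = 1" using False by (simp add: c_def norm_divide)
  have "cinner x (c *\<^sub>C y) = cinner x y * cnj (cinner x y) / cmod (cinner x y)"
    by (simp add: c_def cinner_scaleC_right mult.commute)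
  then have "complex_of_real (cmod (cinner x y)) = cinner x (c *\<^sub>C y)"
    using False by (simp only: complex_norm_square[symmetric]) (simp add: power2_eq_square)
  then have "cmod (cinner x y) = inner x (c *\<^sub>C y)"
    by (metis inner_eq_Re_cinner Re_complex_of_real)
  also have "\<dots> \<le> norm x * norm (c *\<^sub>C y)" by (rule norm_cauchy_schwarz)
  finally show ?thesis by (simp add: norm_scaleC c)
qed simp

lemma bounded_linear_cinner_right: "bounded_linear (cinner (x :: 'a::complex_hilbert_space))"
  by (rule bounded_linear_intro[where K = "norm x"])
    (simp_all add: cinner_add_right scaleR_scaleC cinner_scaleC_right cmod_cinner_le
      scaleC_complex_def mult.commute[of _ "norm x"])

text \<open>The polynomial is the value of a positive form at \<open>x + t y\<close>. This makes the
  lemma the common source of Hermitian symmetry and Cauchy-Schwarz for positive operators, operator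
  matrices and completely positive maps.\<close>

lemma nonneg_quadratic:
  fixes \<alpha> \<beta> \<gamma> \<delta> :: complex
  assumes "\<And>t. \<alpha> + t * \<beta> + cnj t * \<gamma> + t * cnj t * \<delta> \<in> \<real>\<^sub>\<ge>\<^sub>0"
  shows "\<gamma> = cnj \<beta>" and "(cmod \<beta>)\<^sup>2 \<le> Re \<alpha> * Re \<delta>"
proof -
  note nn = assms[unfolded complex_nonneg_Reals_iff]
  have a: "Re \<alpha> \<ge> 0" "Im \<alpha> = 0" using nn[of 0] by auto
  show g: "\<gamma> = cnj \<beta>"
    using nn[of 1] nn[of "-1"] nn[of \<i>] nn[of "- \<i>"] a by (auto simp: complex_eq_iff)
  \<comment> \<open>With \<open>t\<close> along \<open>- cnj \<beta>\<close> each of the two linear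
    terms becomes \<open>- s * (cmod \<beta>)\<^sup>2\<close>, which leaves a real quadratic in
    \<open>s\<close>.\<close>
  have q: "0 \<le> Re \<alpha> - 2 * s * (cmod \<beta>)\<^sup>2 + s\<^sup>2 * (cmod \<beta>)\<^sup>2 * Re \<delta>" for s :: real
    using nn[of "- (s *\<^sub>R cnj \<beta>)"] unfolding g cmod_power2
    by (simp add: power2_eq_square algebra_simps)
  have r: "0 \<le> Re \<alpha> + s\<^sup>2 * Re \<delta>" for s :: real
    using nn[of "of_real s"] nn[of "- of_real s"] by (simp add: power2_eq_square algebra_simps)
  have d: "Re \<delta> \<ge> 0"
  proof (rule ccontr)
    assume n: "\<not> Re \<delta> \<ge> 0"
    have "(Re \<alpha> + 1) / - Re \<delta> \<ge> 0" using a n by (intro divide_nonneg_nonneg) auto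
    then have "(sqrt ((Re \<alpha> + 1) / - Re \<delta>))\<^sup>2 = (Re \<alpha> + 1) / - Re \<delta>"
      by (rule real_sqrt_pow2)
    with r[of "sqrt ((Re \<alpha> + 1) / - Re \<delta>)"] n show False by (simp add: field_simps)
  qed
  show "(cmod \<beta>)\<^sup>2 \<le> Re \<alpha> * Re \<delta>"
  proof (cases "Re \<delta> = 0")
    case True
    have "\<beta> = 0"
    proof (rule ccontr)
      assume "\<beta> \<noteq> 0"
      then show False using q[of "(Re \<alpha> + 1) / (2 * (cmod \<beta>)\<^sup>2)"] True by (simp add: field_simps)
    qed
    then show ?thesis using True by simp
  next
    case False
    then have dp: "Re \<delta> > 0" using d by simp
    have "0 \<le> Re \<alpha> - (cmod \<beta>)\<^sup>2 / Re \<delta>" using q[of "1 / Re \<delta>"] dp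
      by (simp add: field_simps power2_eq_square)
    then show ?thesis using dp by (simp add: field_simps)
  qed
qed

section \<open>Operators\<close>

lemma bop_apply_minus: "bop_apply a (- x) = - bop_apply a x"
  using bop_apply_diff[of a 0 x] by simp

lemma bop_apply_sum_right: "bop_apply a (sum f I) = (\<Sum>i\<in>I. bop_apply a (f i))"
  by (induction I rule: infinite_finite_induct) (simp_all add: bop_apply_add)

lemma bop_apply_sum: "bop_apply (sum f I) x = (\<Sum>i\<in>I. bop_apply (f i) x)"
  by (induction I rule: infinite_finite_induct) (simp_all add: plus_bop.rep_eq zero_bop.rep_eq)

lemmas bop_rep_eqs = zero_bop.rep_eq one_bop.rep_eq plus_bop.rep_eq minus_bop.rep_eq
  uminus_bop.rep_eq times_bop.rep_eq scaleC_bop.rep_eq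

lemma scaleC_zero_left [simp]: "0 *\<^sub>C (x :: 'a::complex_vector) = 0"
  using scaleR_scaleC[of 0 x] by simp

lemma scaleC_bop_mult_left: "c *\<^sub>C a * b = c *\<^sub>C (a * b)" for a b :: "'h::complex_hilbert_space bop"
  by (rule bop_eqI) (simp add: bop_rep_eqs)

lemma scaleC_bop_mult_right: "a * c *\<^sub>C b = c *\<^sub>C (a * b)" for a b :: "'h::complex_hilbert_space bop"
  by (rule bop_eqI) (simp add: bop_rep_eqs bop_apply_scaleC)

lemma cinner_adj_right: "cinner x (bop_apply (adj a) y) = cinner (bop_apply a x) y"
  by (metis cinner_adj cinner_commute)

lemma adj_eqI:
  assumes "\<And>x y. cinner (bop_apply b x) y = cinner x (bop_apply a y)"
  shows "adj a = b"
proof (rule bop_eqI, rule cinner_ext)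
  fix x z
  show "cinner z (bop_apply (adj a) x) = cinner z (bop_apply b x)"
    by (metis assms cinner_adj cinner_commute)
qed

lemma adj_adj [simp]: "adj (adj a) = a"
  by (rule adj_eqI) (simp add: cinner_adj_right)

lemma adj_mult: "adj (a * b) = adj b * adj a"
  by (rule adj_eqI) (simp add: bop_rep_eqs cinner_adj)

lemma adj_one [simp]: "adj 1 = 1"
  by (rule adj_eqI) (simp add: bop_rep_eqs)

lemma adj_add: "adj (a + b) = adj a + adj b"
  by (rule adj_eqI) (simp add: bop_rep_eqs cinner_adj cinner_add_left cinner_add_right)

lemma adj_diff: "adj (a - b) = adj a - adj b"
  by (rule adj_eqI) (simp add: bop_rep_eqs cinner_adj cinner_diff_left cinner_diff_right)

lemma adj_scaleC: "adj (c *\<^sub>C a) = cnj c *\<^sub>C adj a"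
  by (rule adj_eqI) (simp add: bop_rep_eqs cinner_adj cinner_scaleC_left cinner_scaleC_right)

lemma bop_bounded:
  obtains K where "K > 0" "\<And>x. norm (bop_apply a x) \<le> K * norm x"
proof -
  obtain K where "K > 0" "\<And>x. norm (bop_apply a x) \<le> norm x * K"
    using bounded_linear.pos_bounded[OF bounded_linear_bop_apply[of a]] by auto
  then show ?thesis using that by (simp add: mult.commute)
qed

lift_definition rank1 :: "'h::complex_hilbert_space \<Rightarrow> 'h \<Rightarrow> 'h bop" is "\<lambda>u v x. cinner v x *\<^sub>C u"
proof (intro conjI allI)
  fix u v :: 'h
  show "bounded_linear (\<lambda>x. cinner v x *\<^sub>C u)"
  proof (rule bounded_linear_intro[where K = "norm v * norm u"])
    show "norm (cinner v x *\<^sub>C u) \<le> norm x * (norm v * norm u)" for x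
      using mult_right_mono[OF cmod_cinner_le[of v x], of "norm u"]
      by (simp add: norm_scaleC mult_ac)
  qed (simp_all add: cinner_add_right scaleC_add_left scaleR_scaleC cinner_scaleC_right
      scaleC_scaleC)
  show "cinner v (c *\<^sub>C x) *\<^sub>C u = c *\<^sub>C cinner v x *\<^sub>C u" for c x
    by (simp add: cinner_scaleC_right scaleC_scaleC)
qed

lemma rank1_add_left: "rank1 (u + u') v = rank1 u v + rank1 u' v"
  by (rule bop_eqI) (simp add: bop_rep_eqs rank1.rep_eq scaleC_add_right)

lemma rank1_scaleC_left: "rank1 (c *\<^sub>C u) v = c *\<^sub>C rank1 u v"
  by (rule bop_eqI) (simp add: bop_rep_eqs rank1.rep_eq scaleC_scaleC mult.commute)

lemma mult_rank1: "a * rank1 u v = rank1 (bop_apply a u) v"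
  by (rule bop_eqI) (simp add: bop_rep_eqs rank1.rep_eq bop_apply_scaleC)

subsection \<open>The Loewner order\<close>

text \<open>The real part keeps order estimates among real numbers; for positive operators nothing
  is lost (\<open>cinner_nonneg_eq_ev\<close>).\<close>

definition ev :: "'h::complex_hilbert_space \<Rightarrow> 'h bop \<Rightarrow> real" where
  "ev x a = Re (cinner x (bop_apply a x))"

lemma ev_add: "ev x (a + b) = ev x a + ev x b"
  by (simp add: ev_def bop_rep_eqs cinner_add_right)

lemma ev_diff: "ev x (a - b) = ev x a - ev x b"
  by (simp add: ev_def bop_rep_eqs cinner_diff_right)

lemma ev_zero [simp]: "ev x 0 = 0"
  by (simp add: ev_def bop_rep_eqs)

lemma ev_one: "ev x 1 = (norm x)\<^sup>2"
  by (simp add: ev_def bop_rep_eqs cinner_self del: of_real_power)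

lemma ev_scaleR: "ev x (r *\<^sub>R a) = r * ev x a"
  by (simp add: ev_def scaleR_scaleC bop_rep_eqs cinner_scaleC_right)

lemma ev_sum: "ev x (sum f I) = (\<Sum>i\<in>I. ev x (f i))"
  by (simp add: ev_def bop_apply_sum cinner_sum_right)

lemma ev_rank1: "ev x (rank1 u u) = (cmod (cinner u x))\<^sup>2"
proof -
  have "cinner x (bop_apply (rank1 u u) x) = cinner u x * cnj (cinner u x)"
    by (simp add: rank1.rep_eq cinner_scaleC_right flip: cinner_commute)
  then show ?thesis by (simp add: ev_def flip: complex_norm_square)
qed

lemma bop_nonneg_iff: "0 \<le> a \<longleftrightarrow> (\<forall>x. cinner x (bop_apply a x) \<in> \<real>\<^sub>\<ge>\<^sub>0)"
  by (simp add: less_eq_bop_def)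

instance bop :: (complex_hilbert_space) ordered_real_vector
proof
  fix a b c :: "'a bop" and r s :: real
  show "a \<le> b \<Longrightarrow> c + a \<le> c + b" by (simp add: less_eq_bop_def)
  show "a \<le> b \<Longrightarrow> 0 \<le> r \<Longrightarrow> r *\<^sub>R a \<le> r *\<^sub>R b"
    by (auto simp: less_eq_bop_def bop_rep_eqs scaleR_scaleC cinner_diff_right
        cinner_scaleC_right right_diff_distrib simp flip: right_diff_distrib
        intro!: nonneg_Reals_mult_I)
  show "r \<le> s \<Longrightarrow> 0 \<le> a \<Longrightarrow> r *\<^sub>R a \<le> s *\<^sub>R a"
    by (auto simp: less_eq_bop_def bop_rep_eqs scaleR_scaleC cinner_diff_right
        cinner_scaleC_right simp flip: left_diff_distrib of_real_diff
        intro!: nonneg_Reals_mult_I)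
qed

lemma ev_mono: "a \<le> b \<Longrightarrow> ev x a \<le> ev x b"
  by (auto simp: less_eq_bop_def ev_def bop_rep_eqs cinner_diff_right complex_nonneg_Reals_iff)

lemma ev_nonneg: "0 \<le> a \<Longrightarrow> 0 \<le> ev x a"
  using ev_mono[of 0 a] by simp

lemma cinner_nonneg_eq_ev: "0 \<le> a \<Longrightarrow> cinner x (bop_apply a x) = complex_of_real (ev x a)"
  by (auto simp: bop_nonneg_iff ev_def complex_nonneg_Reals_iff complex_eq_iff)

lemma bop_one_nonneg: "0 \<le> (1 :: 'h::complex_hilbert_space bop)"
  by (simp add: bop_nonneg_iff bop_rep_eqs cinner_self del: of_real_power)

lemma rank1_nonneg: "0 \<le> rank1 u u"
proof -
  have "cinner x (bop_apply (rank1 u u) x) = complex_of_real ((cmod (cinner u x))\<^sup>2)" for x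
    by (simp only: rank1.rep_eq cinner_scaleC_right complex_norm_square cinner_commute[symmetric])
  then show ?thesis by (simp add: bop_nonneg_iff del: of_real_power)
qed

lemma nonneg_selfadjoint:
  assumes "0 \<le> a"
  shows "adj a = a"
    and nonneg_cauchy_schwarz: "(cmod (cinner x (bop_apply a y)))\<^sup>2 \<le> ev x a * ev y a"
proof -
  have nn: "cinner x (bop_apply a x) + t * cinner x (bop_apply a y) + cnj t * cinner y (bop_apply a x)
      + t * cnj t * cinner y (bop_apply a y) \<in> \<real>\<^sub>\<ge>\<^sub>0" for t x y
  proof -
    have "cinner (x + t *\<^sub>C y) (bop_apply a (x + t *\<^sub>C y)) \<in> \<real>\<^sub>\<ge>\<^sub>0"
      using assms by (simp add: bop_nonneg_iff)
    then show ?thesis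
      by (simp add: bop_apply_add bop_apply_scaleC cinner_add_left cinner_add_right
          cinner_scaleC_left cinner_scaleC_right algebra_simps)
  qed
  show "adj a = a"
    by (rule adj_eqI) (metis nonneg_quadratic(1)[OF nn] cinner_commute)
  show "(cmod (cinner x (bop_apply a y)))\<^sup>2 \<le> ev x a * ev y a"
    using nonneg_quadratic(2)[OF nn] by (simp add: ev_def)
qed

text \<open>Quadratic forms of self-adjoint operators are real, so the complex positivity in the
  Loewner order reduces to real inequalities.\<close>

lemma selfadjoint_le_iff:
  assumes "adj a = a" "adj b = b"
  shows "a \<le> b \<longleftrightarrow> (\<forall>x. ev x a \<le> ev x b)"
proof -
  have "Im (cinner x (bop_apply c x)) = 0" if "adj c = c" for c :: "'a bop" and x
  proof -
    have "cinner x (bop_apply c x) = cnj (cinner x (bop_apply c x))"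
      by (metis that cinner_adj cinner_commute)
    then show ?thesis by (metis cnj.simps(2) equal_neg_zero)
  qed
  then show ?thesis using assms
    by (simp add: less_eq_bop_def ev_def bop_rep_eqs cinner_diff_right complex_nonneg_Reals_iff)
qed

lemma nonneg_eqI:
  assumes "0 \<le> a" "0 \<le> b" "\<And>x. ev x a = ev x b"
  shows "a = b"
  using assms by (intro order.antisym) (simp_all add: selfadjoint_le_iff nonneg_selfadjoint)

text \<open>This is \<open>a * a \<le> a\<close> for an effect, obtained without square roots:
  Cauchy-Schwarz for the form of \<open>a\<close> at the vectors \<open>a x\<close> and
  \<open>x\<close>. It turns small expectations into small norms.\<close>

lemma norm_sq_le_ev:
  assumes "0 \<le> a" "a \<le> 1"
  shows "(norm (bop_apply a x))\<^sup>2 \<le> ev x a"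
proof (cases "bop_apply a x = 0")
  case True
  then show ?thesis using ev_nonneg[OF assms(1)] by simp
next
  case False
  let ?y = "bop_apply a x"
  have "((norm ?y)\<^sup>2)\<^sup>2 = (cmod (cinner ?y (bop_apply a x)))\<^sup>2"
    by (simp add: cinner_self norm_power)
  also have "\<dots> \<le> ev ?y a * ev x a" by (rule nonneg_cauchy_schwarz[OF assms(1)])
  also have "\<dots> \<le> (norm ?y)\<^sup>2 * ev x a"
    using ev_mono[OF assms(2), of ?y] ev_nonneg[OF assms(1)] by (simp add: ev_one mult_right_mono)
  finally have "(norm ?y)\<^sup>2 * (norm ?y)\<^sup>2 \<le> (norm ?y)\<^sup>2 * ev x a"
    by (simp only: power2_eq_square)
  then show ?thesis using False by (subst (asm) mult_le_cancel_left_pos) auto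
qed

lemma selfadjoint_le_scaleR:
  assumes "adj a = a"
  obtains c where "c > 0" "a \<le> c *\<^sub>R 1"
proof -
  obtain K where K: "K > 0" "\<And>x. norm (bop_apply a x) \<le> K * norm x" using bop_bounded by blast
  have "ev x a \<le> ev x (K *\<^sub>R 1)" for x
  proof -
    have "ev x a \<le> norm x * norm (bop_apply a x)"
      unfolding ev_def using cmod_cinner_le[of x "bop_apply a x"] complex_Re_le_cmod order_trans by blast
    also have "\<dots> \<le> norm x * (K * norm x)" by (rule mult_left_mono[OF K(2)]) simp
    finally show ?thesis by (simp add: ev_scaleR ev_one power2_eq_square mult_ac)
  qed
  then have "a \<le> K *\<^sub>R 1"
    using assms by (subst selfadjoint_le_iff) (simp_all add: scaleR_scaleC adj_scaleC)
  then show ?thesis using K(1) that by blast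
qed

lemma bop_cartesian:
  fixes a :: "'h::complex_hilbert_space bop"
  obtains h k where "a = h + \<i> *\<^sub>C k" "adj h = h" "adj k = k"
    "h = (1/2) *\<^sub>C (a + adj a)" "k = (- \<i> / 2) *\<^sub>C (a - adj a)"
proof -
  define h where "h = (1/2) *\<^sub>C (a + adj a)"
  define k where "k = (- \<i> / 2) *\<^sub>C (a - adj a)"
  have "adj h = h" by (simp add: h_def adj_scaleC adj_add add.commute)
  moreover have "adj k = k"
  proof -
    have "- k = (\<i> / 2) *\<^sub>C (a - adj a)"
      using scaleC_add_left[of "- \<i> / 2" "\<i> / 2" "a - adj a"]
      by (simp add: k_def eq_neg_iff_add_eq_0 neg_eq_iff_add_eq_0)
    then have "k = - ((\<i> / 2) *\<^sub>C (a - adj a))" by (metis minus_minus)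
    then have "k = (\<i> / 2) *\<^sub>C - (a - adj a)" by (simp only: scaleC_minus_right)
    then show ?thesis by (simp add: k_def adj_scaleC adj_diff)
  qed
  moreover have "a = h + \<i> *\<^sub>C k"
  proof -
    have "h + \<i> *\<^sub>C k = (1/2) *\<^sub>C ((a + adj a) + (a - adj a))"
      by (simp add: h_def k_def scaleC_scaleC flip: scaleC_add_right)
    also have "\<dots> = (1/2) *\<^sub>C (2 *\<^sub>C a)"
      using scaleC_add_left[of 1 1 a] by simp
    finally show ?thesis by (simp add: scaleC_scaleC)
  qed
  ultimately show ?thesis using that h_def k_def by blast
qed

section \<open>Normality\<close>

text \<open>Vigier's theorem at a single vector: a decreasing net of effects converges strongly. The
  net is replaced by sequences that stay below any given \<open>q\<close>, all with the same limit
  \<open>v\<close>. If \<open>c \<le> a\<close> and the expectation of \<open>a\<close> is near the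
  infimum, then \<open>a - c\<close> is small at \<open>x\<close> by
  \<open>norm_sq_le_ev\<close>.\<close>

lemma directed_limit:
  fixes Q :: "'h::complex_hilbert_space bop set"
  assumes ne: "Q \<noteq> {}" and bd: "\<And>q. q \<in> Q \<Longrightarrow> 0 \<le> q \<and> q \<le> 1"
    and dir: "\<And>a b. a \<in> Q \<Longrightarrow> b \<in> Q \<Longrightarrow> \<exists>c\<in>Q. c \<le> a \<and> c \<le> b"
  shows "\<exists>v. \<forall>q\<in>Q. \<exists>h. (\<forall>n. h n \<in> Q \<and> h n \<le> q) \<and> (\<lambda>n::nat. bop_apply (h n) x) \<longlonglongrightarrow> v"
proof -
  define m where "m = Inf (ev x ` Q)"
  have bdd: "bdd_below (ev x ` Q)" by (rule bdd_belowI2[of _ 0]) (use bd ev_nonneg in blast)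
  have m_le: "m \<le> ev x q" if "q \<in> Q" for q
    unfolding m_def using that by (intro cInf_lower[OF _ bdd]) simp
  have close: "(norm (bop_apply a x - bop_apply c x))\<^sup>2 < e"
    if "a \<in> Q" "c \<in> Q" "c \<le> a" "ev x a < m + e" for a c e
  proof -
    have "a - c \<le> 1" using bd[OF that(1)] bd[OF that(2)] by (metis diff_mono diff_zero)
    then have "(norm (bop_apply (a - c) x))\<^sup>2 \<le> ev x (a - c)"
      using that(3) by (intro norm_sq_le_ev) simp_all
    then show ?thesis using that(4) m_le[OF that(2)] by (simp add: ev_diff minus_bop.rep_eq)
  qed
  have "\<exists>q\<in>Q. ev x q < m + 1 / Suc n" for n
  proof -
    have "Inf (ev x ` Q) < m + 1 / Suc n" by (simp add: m_def)
    then show ?thesis using cInf_less_iff[OF _ bdd] ne by auto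
  qed
  then obtain g where g: "\<And>n. g n \<in> Q" "\<And>n. ev x (g n) < m + 1 / Suc n" by metis
  have "Cauchy (\<lambda>n. bop_apply (g n) x)"
  proof (rule metric_CauchyI)
    fix e :: real assume e: "0 < e"
    obtain N where N: "1 / real (Suc N) < (e / 2)\<^sup>2"
      using e reals_Archimedean[of "(e / 2)\<^sup>2"] by (auto simp: inverse_eq_divide)
    have "dist (bop_apply (g i) x) (bop_apply (g j) x) < e" if "i \<ge> N" "j \<ge> N" for i j
    proof -
      \<comment> \<open>The sequence \<open>g\<close> need not decrease, so two of its members are
        compared through a common lower bound in \<open>Q\<close>, where the expectation cannot drop
        below \<open>m\<close>.\<close>
      obtain c where c: "c \<in> Q" "c \<le> g i" "c \<le> g j" using dir g(1) by meson
      have *: "norm (bop_apply (g k) x - bop_apply c x) < e / 2" if "k \<ge> N" "c \<le> g k" for k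
      proof -
        have "1 / real (Suc k) \<le> 1 / real (Suc N)" using that by (auto intro!: divide_left_mono)
        then have "(norm (bop_apply (g k) x - bop_apply c x))\<^sup>2 < (e / 2)\<^sup>2"
          using N g(2)[of k] by (intro close g c that) linarith
        then show ?thesis by (rule power2_less_imp_less) (use e in simp)
      qed
      show ?thesis
        by (rule dist_triangle_half_l[of _ "bop_apply c x"]; unfold dist_norm)
          (rule *[OF that(1) c(2)], rule *[OF that(2) c(3)])
    qed
    then show "\<exists>M. \<forall>i\<ge>M. \<forall>j\<ge>M. dist (bop_apply (g i) x) (bop_apply (g j) x) < e" by blast
  qed
  then obtain v where v: "(\<lambda>n. bop_apply (g n) x) \<longlonglongrightarrow> v" using Cauchy_convergent convergent_def by blast
  show ?thesis
  proof (intro exI[of _ v] ballI)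
    fix q assume q: "q \<in> Q"
    obtain h where h: "\<And>n. h n \<in> Q" "\<And>n. h n \<le> g n" "\<And>n. h n \<le> q"
      using dir[OF g(1) q] by metis
    have sq: "(\<lambda>n. sqrt (1 / real (Suc n))) \<longlonglongrightarrow> 0"
      using tendsto_real_sqrt[OF LIMSEQ_Suc[OF lim_1_over_n[where 'a = real]]] by simp
    have "(\<lambda>n. bop_apply (g n) x - bop_apply (h n) x) \<longlonglongrightarrow> 0"
    proof (rule Lim_null_comparison[OF _ sq])
      have "norm (bop_apply (g n) x - bop_apply (h n) x) \<le> sqrt (1 / real (Suc n))" for n
        by (intro real_le_rsqrt less_imp_le close g h)
      then show "\<forall>\<^sub>F n in sequentially. norm (bop_apply (g n) x - bop_apply (h n) x) \<le> sqrt (1 / real (Suc n))"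
        by simp
    qed
    from tendsto_diff[OF v this] have "(\<lambda>n. bop_apply (h n) x) \<longlonglongrightarrow> v" by simp
    with h show "\<exists>h. (\<forall>n. h n \<in> Q \<and> h n \<le> q) \<and> (\<lambda>n. bop_apply (h n) x) \<longlonglongrightarrow> v" by blast
  qed
qed

section \<open>Orthonormal sets and their finite-rank projections\<close>

definition orthonormal :: "'h::complex_hilbert_space set \<Rightarrow> bool" where
  "orthonormal B \<longleftrightarrow> (\<forall>e\<in>B. norm e = 1) \<and> (\<forall>e\<in>B. \<forall>f\<in>B. e \<noteq> f \<longrightarrow> cinner e f = 0)"

lemma orthonormal_subset: "orthonormal B \<Longrightarrow> F \<subseteq> B \<Longrightarrow> orthonormal F"
  by (auto simp: orthonormal_def)

text \<open>A maximal orthonormal set from Zorn's lemma. Completeness is put as triviality of the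
  orthogonal complement, the form in which \<open>isLub_onproj\<close> uses it, with no expansion of
  vectors.\<close>

lemma ex_complete_orthonormal:
  "\<exists>B :: 'h::complex_hilbert_space set. orthonormal B \<and> (\<forall>x. (\<forall>e\<in>B. cinner e x = 0) \<longrightarrow> x = 0)"
proof -
  have "\<exists>M\<in>{B :: 'h set. orthonormal B}. \<forall>X\<in>{B. orthonormal B}. M \<subseteq> X \<longrightarrow> X = M"
  proof (rule subset_Zorn')
    fix C :: "'h set set" assume "subset.chain {B. orthonormal B} C"
    then have C: "\<And>X. X \<in> C \<Longrightarrow> orthonormal X" "\<And>X Y. X \<in> C \<Longrightarrow> Y \<in> C \<Longrightarrow> X \<subseteq> Y \<or> Y \<subseteq> X"
      by (auto simp: subset_chain_def)
    have "cinner e f = 0" if "e \<in> X" "X \<in> C" "f \<in> Y" "Y \<in> C" "e \<noteq> f" for e f X Y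
      using C(2)[OF that(2,4)] C(1)[OF that(2)] C(1)[OF that(4)] that
      unfolding orthonormal_def by blast
    moreover have "norm e = 1" if "e \<in> X" "X \<in> C" for e X
      using that C(1) by (auto simp: orthonormal_def)
    ultimately show "\<Union>C \<in> {B. orthonormal B}" by (auto simp: orthonormal_def)
  qed
  then obtain B :: "'h set" where B: "orthonormal B" "\<And>X. orthonormal X \<Longrightarrow> B \<subseteq> X \<Longrightarrow> X = B" by blast
  have "x = 0" if x: "\<forall>e\<in>B. cinner e x = 0" for x
  proof (rule ccontr)
    assume n: "x \<noteq> 0"
    define y where "y = complex_of_real (1 / norm x) *\<^sub>C x"
    have y: "norm y = 1" using n by (simp add: y_def norm_scaleC norm_divide)
    have o: "cinner e y = 0" "cinner y e = 0" if "e \<in> B" for e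
      using x that by (auto simp: y_def cinner_scaleC_right cinner_scaleC_left cinner_commute[of x])
    have "orthonormal (insert y B)" using B(1) y o by (auto simp: orthonormal_def)
    then have "y \<in> B" using B(2) by blast
    then have "cinner y y = 0" using o by blast
    then show False using y by (simp add: cinner_self)
  qed
  with B(1) show ?thesis by blast
qed

definition onproj :: "'h::complex_hilbert_space set \<Rightarrow> 'h bop" where
  "onproj F = (\<Sum>e\<in>F. rank1 e e)"

lemma onproj_nonneg: "0 \<le> onproj F"
  unfolding onproj_def by (intro sum_nonneg rank1_nonneg)

lemma onproj_mono: "finite G \<Longrightarrow> F \<subseteq> G \<Longrightarrow> onproj F \<le> onproj G"
  unfolding onproj_def by (intro sum_mono2 rank1_nonneg)

lemma onproj_apply: "finite F \<Longrightarrow> orthonormal F \<Longrightarrow> e \<in> F \<Longrightarrow> bop_apply (onproj F) e = e"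
proof -
  assume a: "finite F" "orthonormal F" "e \<in> F"
  have "bop_apply (onproj F) e = (\<Sum>f\<in>F. if f = e then e else 0)"
    unfolding onproj_def bop_apply_sum rank1.rep_eq using a
    by (intro sum.cong) (auto simp: orthonormal_def cinner_self)
  then show ?thesis using a by simp
qed

lemma mult_onproj:
  assumes "\<And>e. e \<in> F \<Longrightarrow> bop_apply a e = b e"
  shows "bop_apply a (bop_apply (onproj F) x) = (\<Sum>e\<in>F. cinner e x *\<^sub>C b e)"
  by (simp add: onproj_def bop_apply_sum bop_apply_sum_right rank1.rep_eq bop_apply_scaleC assms)

lemma onproj_idem:
  assumes "finite F" "orthonormal F"
  shows "onproj F * onproj F = onproj F"
proof (rule bop_eqI)
  fix x
  have "bop_apply (onproj F) (bop_apply (onproj F) x) = (\<Sum>e\<in>F. cinner e x *\<^sub>C e)"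
    by (rule mult_onproj) (rule onproj_apply[OF assms])
  then show "bop_apply (onproj F * onproj F) x = bop_apply (onproj F) x"
    by (simp add: times_bop.rep_eq) (simp add: onproj_def bop_apply_sum rank1.rep_eq)
qed

text \<open>For \<open>q = 1 - onproj F\<close>, the hypotheses give \<open>a = q a q \<le> q\<close>.\<close>
lemma le_one_minus_onproj:
  assumes F: "finite F" "orthonormal F" and a: "0 \<le> a" "a \<le> 1"
    and ker: "\<And>e. e \<in> F \<Longrightarrow> bop_apply a e = 0"
  shows "a \<le> 1 - onproj F"
proof -
  let ?p = "onproj F"
  have sa: "adj ?p = ?p" "adj a = a" by (intro nonneg_selfadjoint onproj_nonneg a)+
  have "a * ?p = 0" by (rule bop_eqI) (simp add: times_bop.rep_eq zero_bop.rep_eq mult_onproj[OF ker])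
  then have ap: "bop_apply a (bop_apply ?p x) = 0" for x
    by (metis times_bop.rep_eq zero_bop.rep_eq)
  have pp: "bop_apply ?p (bop_apply ?p x) = bop_apply ?p x" for x
    by (metis onproj_idem[OF F] times_bop.rep_eq)
  have sw: "cinner (bop_apply ?p x) y = cinner x (bop_apply ?p y)"
    "cinner (bop_apply a x) y = cinner x (bop_apply a y)" for x y by (metis cinner_adj sa)+
  have "ev x a \<le> ev x (1 - ?p)" for x
  proof -
    let ?y = "x - bop_apply ?p x"
    have "cinner ?y (bop_apply a ?y) = cinner x (bop_apply a x)"
      by (simp add: cinner_diff_left bop_apply_diff ap flip: sw(2))
    then have "ev x a = ev ?y a" by (simp add: ev_def)
    also have "\<dots> \<le> ev ?y 1" by (rule ev_mono[OF a(2)])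
    also have "\<dots> = ev x (1 - ?p)"
      by (simp add: ev_def one_bop.rep_eq minus_bop.rep_eq cinner_diff_left cinner_diff_right sw pp)
    finally show ?thesis .
  qed
  then show ?thesis by (subst selfadjoint_le_iff) (simp_all add: sa adj_diff)
qed

lemma onproj_le_one: "finite F \<Longrightarrow> orthonormal F \<Longrightarrow> onproj F \<le> 1"
  using le_one_minus_onproj[of F 0] bop_one_nonneg by (simp add: zero_bop.rep_eq)

section \<open>Suprema in the Loewner order and normal maps\<close>

lemma isLub_UNIV_image_I:
  assumes "\<And>i. i \<in> I \<Longrightarrow> f i \<le> x" "\<And>b. (\<And>i. i \<in> I \<Longrightarrow> f i \<le> b) \<Longrightarrow> x \<le> b"
  shows "isLub UNIV (f ` I) x"
proof -
  have "x \<le> b" if "\<forall>i\<in>I. f i \<le> b" for b by (rule assms(2)) (use that in blast)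
  with assms(1) show ?thesis by (simp add: isLub_def leastP_def isUb_def setle_def setge_def)
qed

lemma isLub_UNIV_image_least:
  assumes "isLub UNIV (f ` I) x" "\<And>i. i \<in> I \<Longrightarrow> f i \<le> b"
  shows "x \<le> b"
  using assms by (simp add: isLub_def leastP_def isUb_def setle_def setge_def)

text \<open>At each \<open>x\<close> the complements \<open>1 - onproj F\<close> have a limit vector
  \<open>v\<close>. Sequences below \<open>1 - onproj {e}\<close> show that \<open>v\<close> is
  orthogonal to \<open>e\<close>, so \<open>v = 0\<close> by completeness. The gaps
  \<open>ev x (1 - onproj F)\<close> thus become arbitrarily small, and no upper bound can have an
  expectation below that of \<open>1\<close>.\<close>

lemma isLub_onproj:
  fixes B :: "'h::complex_hilbert_space set"
  assumes B: "orthonormal B" and complete: "\<And>x. (\<And>e. e \<in> B \<Longrightarrow> cinner e x = 0) \<Longrightarrow> x = 0"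
  shows "isLub UNIV (onproj ` {F. finite F \<and> F \<subseteq> B}) 1"
proof -
  let ?Fs = "{F. finite F \<and> F \<subseteq> B}"
  have le1: "onproj F \<le> 1" if "F \<in> ?Fs" for F
    using that orthonormal_subset[OF B] by (auto intro: onproj_le_one)
  have "1 \<le> b" if ub: "\<And>F. F \<in> ?Fs \<Longrightarrow> onproj F \<le> b" for b
  proof -
    have b0: "0 \<le> b" using ub[of "{}"] by (simp add: onproj_def)
    have "ev x 1 \<le> ev x b" for x
    proof -
      let ?Q = "(\<lambda>F. 1 - onproj F) ` ?Fs"
      have "\<exists>v. \<forall>q\<in>?Q. \<exists>h. (\<forall>n. h n \<in> ?Q \<and> h n \<le> q) \<and> (\<lambda>n::nat. bop_apply (h n) x) \<longlonglongrightarrow> v"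
      proof (rule directed_limit)
        show "?Q \<noteq> {}" by auto
        show "0 \<le> q \<and> q \<le> 1" if "q \<in> ?Q" for q
          using that le1 onproj_nonneg by auto
        show "\<exists>c\<in>?Q. c \<le> a \<and> c \<le> b" if ab: "a \<in> ?Q" "b \<in> ?Q" for a b
        proof -
          obtain F G where "a = 1 - onproj F" "b = 1 - onproj G" "F \<in> ?Fs" "G \<in> ?Fs"
        using ab by blast
          then show ?thesis by (intro bexI[of _ "1 - onproj (F \<union> G)"]) (auto intro: onproj_mono)
        qed
      qed
      then obtain v where v: "\<And>q. q \<in> ?Q \<Longrightarrow>
          \<exists>h. (\<forall>n. h n \<in> ?Q \<and> h n \<le> q) \<and> (\<lambda>n::nat. bop_apply (h n) x) \<longlonglongrightarrow> v" by blast
      have "v = 0"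
      proof (rule complete)
        fix e assume e: "e \<in> B"
        have "1 - onproj {e} \<in> ?Q" using e by blast
        from v[OF this] obtain h where h: "\<And>n. h n \<in> ?Q" "\<And>n. h n \<le> 1 - onproj {e}"
          "(\<lambda>n::nat. bop_apply (h n) x) \<longlonglongrightarrow> v" by blast
        have "cinner e (bop_apply (h n) x) = 0" for n
        proof -
          have pos: "0 \<le> h n" using h(1)[of n] le1 by auto
          have "ev e (1 - onproj {e}) = 0"
            using onproj_apply[of "{e}" e] B e orthonormal_subset[OF B, of "{e}"]
            by (simp add: ev_def minus_bop.rep_eq one_bop.rep_eq)
          then have "ev e (h n) = 0" using ev_mono[OF h(2), of e n] ev_nonneg[OF pos, of e] by simp
          then show ?thesis using nonneg_cauchy_schwarz[OF pos, of e x] by simp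
        qed
        then have "(\<lambda>n. 0) \<longlonglongrightarrow> cinner e v"
          using bounded_linear.tendsto[OF bounded_linear_cinner_right h(3), of e] by simp
        then show "cinner e v = 0" by (simp add: LIMSEQ_const_iff)
      qed
      have "1 - onproj {} \<in> ?Q" by blast
      from v[OF this] obtain h where h: "\<And>n. h n \<in> ?Q" "(\<lambda>n::nat. bop_apply (h n) x) \<longlonglongrightarrow> 0"
        using \<open>v = 0\<close> by blast
      have "ev x 1 - ev x b \<le> ev x (h n)" for n
      proof -
        obtain F where "h n = 1 - onproj F" "F \<in> ?Fs" using h(1) by blast
        then show ?thesis using ev_mono[OF ub, of F x] by (simp add: ev_diff)
      qed
      moreover have "(\<lambda>n. ev x (h n)) \<longlonglongrightarrow> 0"
        using tendsto_Re[OF bounded_linear.tendsto[OF bounded_linear_cinner_right h(2), of x]]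
        by (simp add: ev_def)
      ultimately have "ev x 1 - ev x b \<le> 0" by (intro LIMSEQ_le_const) auto
      then show ?thesis by simp
    qed
    then show ?thesis by (subst selfadjoint_le_iff) (simp_all add: nonneg_selfadjoint b0)
  qed
  with le1 show ?thesis by (rule isLub_UNIV_image_I)
qed

lemma normal_mapD:
  assumes "normal_map \<Phi>" "D \<noteq> {}" "\<And>a. a \<in> D \<Longrightarrow> 0 \<le> a"
    "\<And>a b. a \<in> D \<Longrightarrow> b \<in> D \<Longrightarrow> \<exists>c\<in>D. a \<le> c \<and> b \<le> c" "isLub UNIV D x"
  shows "isLub UNIV (\<Phi> ` D) (\<Phi> x)"
  by (rule assms(1)[unfolded normal_map_def, rule_format]) (intro conjI ballI assms)

lemma normal_map_comp:
  assumes "normal_map \<Phi>" "normal_map \<Psi>" "\<And>a. 0 \<le> a \<Longrightarrow> 0 \<le> \<Psi> a" "mono \<Psi>"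
  shows "normal_map (\<Phi> \<circ> \<Psi>)"
  unfolding normal_map_def
proof (intro allI impI, elim conjE)
  fix D :: "'a bop set" and x
  assume D: "D \<noteq> {}" "\<forall>a\<in>D. 0 \<le> a" "\<forall>a\<in>D. \<forall>b\<in>D. \<exists>c\<in>D. a \<le> c \<and> b \<le> c" "isLub UNIV D x"
  have lub: "isLub UNIV (\<Psi> ` D) (\<Psi> x)"
    by (rule normal_mapD[OF assms(2) D(1) D(2)[rule_format] D(3)[rule_format] D(4)])
  have "isLub UNIV (\<Phi> ` \<Psi> ` D) (\<Phi> (\<Psi> x))"
  proof (rule normal_mapD[OF assms(1) _ _ _ lub])
    show "\<Psi> ` D \<noteq> {}" "\<And>a. a \<in> \<Psi> ` D \<Longrightarrow> 0 \<le> a" using D(1,2) assms(3) by auto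
    fix a b assume "a \<in> \<Psi> ` D" "b \<in> \<Psi> ` D"
    then obtain a' b' where ab: "a' \<in> D" "b' \<in> D" "a = \<Psi> a'" "b = \<Psi> b'" by blast
    then obtain c where "c \<in> D" "a' \<le> c" "b' \<le> c" using D(3) by blast
    then show "\<exists>c\<in>\<Psi> ` D. a \<le> c \<and> b \<le> c"
      using ab by (intro bexI[of _ "\<Psi> c"]) (simp_all add: monoD[OF assms(4)])
  qed
  then show "isLub UNIV ((\<Phi> \<circ> \<Psi>) ` D) ((\<Phi> \<circ> \<Psi>) x)" by (simp add: image_comp)
qed

lemma complex_linear_map_add: "complex_linear_map \<Phi> \<Longrightarrow> \<Phi> (a + b) = \<Phi> a + \<Phi> b"
  by (simp add: complex_linear_map_def)

lemma complex_linear_map_diff: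
  assumes "complex_linear_map \<Phi>" shows "\<Phi> (a - b) = \<Phi> a - \<Phi> b"
proof -
  have "\<Phi> (a - b) + \<Phi> b = \<Phi> (a - b + b)" using assms by (simp only: complex_linear_map_add)
  then show ?thesis by (simp add: eq_diff_eq)
qed

lemma complex_linear_map_zero: "complex_linear_map \<Phi> \<Longrightarrow> \<Phi> 0 = 0"
  using complex_linear_map_diff[of \<Phi> 0 0] by simp

lemma complex_linear_map_sum: "complex_linear_map \<Phi> \<Longrightarrow> \<Phi> (sum f I) = (\<Sum>i\<in>I. \<Phi> (f i))"
  by (induction I rule: infinite_finite_induct)
    (simp_all add: complex_linear_map_zero complex_linear_map_add)

text \<open>Turns normality, a statement about suprema, into a numerical estimate. If all
  expectations were at least \<epsilon>, the limit vector \<open>v\<close> of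
  \<open>directed_limit\<close> would be nonzero and a multiple \<open>c\<close> of
  \<open>rank1 v v\<close> would lie below every \<open>\<Phi> (1 - onproj F)\<close>. Then
  \<open>1 - c\<close> would bound all \<open>\<Phi> (onproj F)\<close>, although their supremum is
  \<open>1\<close>.\<close>

lemma normal_onproj_small:
  fixes B :: "'h::complex_hilbert_space set"
  assumes B: "orthonormal B" "\<And>x. (\<And>e. e \<in> B \<Longrightarrow> cinner e x = 0) \<Longrightarrow> x = 0"
    and \<Phi>: "complex_linear_map \<Phi>" "normal_map \<Phi>" "\<Phi> 1 = 1" "mono \<Phi>" and e: "0 < \<epsilon>"
  shows "\<exists>F. finite F \<and> F \<subseteq> B \<and> ev x (\<Phi> (1 - onproj F)) < \<epsilon>"
proof (rule ccontr)
  assume neg: "\<not> ?thesis"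
  let ?Fs = "{F. finite F \<and> F \<subseteq> B}"
  let ?q = "\<lambda>F. \<Phi> (1 - onproj F)"
  let ?Q = "?q ` ?Fs"
  note diff = complex_linear_map_diff[OF \<Phi>(1)] and zero = complex_linear_map_zero[OF \<Phi>(1)]
  have pos: "0 \<le> \<Phi> a" if "0 \<le> a" for a using monoD[OF \<Phi>(4) that] zero by simp
  have le1: "onproj F \<le> 1" if "F \<in> ?Fs" for F
    using that orthonormal_subset[OF B(1)] by (auto intro: onproj_le_one)
  have lub: "isLub UNIV (\<Phi> ` onproj ` ?Fs) (\<Phi> 1)"
  proof -
    have "\<exists>c\<in>onproj ` ?Fs. a \<le> c \<and> b \<le> c" if ab: "a \<in> onproj ` ?Fs" "b \<in> onproj ` ?Fs" for a b
    proof -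
      obtain F G where "a = onproj F" "b = onproj G" "F \<in> ?Fs" "G \<in> ?Fs"
        using ab by blast
      then show ?thesis by (intro bexI[of _ "onproj (F \<union> G)"]) (auto intro: onproj_mono)
    qed
    moreover have "isLub UNIV (onproj ` ?Fs) 1" by (rule isLub_onproj) (use B in auto)
    moreover have "onproj ` ?Fs \<noteq> {}" by auto
    ultimately show ?thesis by (intro normal_mapD \<Phi>(2)) (auto simp: onproj_nonneg)
  qed
  have bd: "0 \<le> q \<and> q \<le> 1" if q: "q \<in> ?Q" for q
  proof -
    obtain F where F: "F \<in> ?Fs" "q = ?q F" using q by auto
    then show ?thesis using pos[of "1 - onproj F"] monoD[OF \<Phi>(4), of "1 - onproj F" 1] le1 \<Phi>(3)
        onproj_nonneg[of F] by simp
  qed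
  have "\<exists>v. \<forall>q\<in>?Q. \<exists>h. (\<forall>n. h n \<in> ?Q \<and> h n \<le> q) \<and> (\<lambda>n::nat. bop_apply (h n) x) \<longlonglongrightarrow> v"
  proof (rule directed_limit[OF _ bd])
    show "?Q \<noteq> {}" by auto
    show "\<exists>c\<in>?Q. c \<le> a \<and> c \<le> b" if ab: "a \<in> ?Q" "b \<in> ?Q" for a b
    proof -
      obtain F G where "a = ?q F" "b = ?q G" "F \<in> ?Fs" "G \<in> ?Fs"
        using ab by blast
      then show ?thesis
        by (intro bexI[of _ "?q (F \<union> G)"]) (auto intro!: monoD[OF \<Phi>(4)] onproj_mono)
    qed
  qed
  then obtain v where v: "\<And>q. q \<in> ?Q \<Longrightarrow>
      \<exists>h. (\<forall>n. h n \<in> ?Q \<and> h n \<le> q) \<and> (\<lambda>n::nat. bop_apply (h n) x) \<longlonglongrightarrow> v" by blast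
  have "v \<noteq> 0"
  proof
    assume "v = 0"
    moreover have "?q {} \<in> ?Q" by blast
    ultimately obtain h where h: "\<And>n. h n \<in> ?Q" "(\<lambda>n::nat. bop_apply (h n) x) \<longlonglongrightarrow> 0"
      using v[of "?q {}"] by blast
    have "(\<lambda>n. ev x (h n)) \<longlonglongrightarrow> 0"
      using tendsto_Re[OF bounded_linear.tendsto[OF bounded_linear_cinner_right h(2), of x]]
      by (simp add: ev_def)
    moreover have "\<epsilon> \<le> ev x (h n)" for n using h(1)[of n] neg by (force simp: not_less)
    ultimately have "\<epsilon> \<le> 0" by (intro LIMSEQ_le_const) auto
    then show False using e by simp
  qed
  \<comment> \<open>A bound for all expectations at \<open>x\<close>, increased by one so that it is
    positive even for \<open>x = 0\<close>.\<close>
  define K where "K = (norm x)\<^sup>2 + 1"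
  have K: "K > 0" by (simp add: K_def add_nonneg_pos)
  define c where "c = (1 / K) *\<^sub>R rank1 v v"
  have c0: "0 \<le> c" unfolding c_def using K by (intro scaleR_nonneg_nonneg rank1_nonneg) simp
  have c_le: "c \<le> q" if q: "q \<in> ?Q" for q
  proof -
    obtain h where h: "\<And>n. h n \<in> ?Q" "\<And>n. h n \<le> q" "(\<lambda>n::nat. bop_apply (h n) x) \<longlonglongrightarrow> v"
      using v[OF q] by blast
    \<comment> \<open>In the limit, Cauchy-Schwarz for \<open>h n\<close> at \<open>y\<close> and
      \<open>x\<close> bounds \<open>(cmod (cinner y v))\<^sup>2\<close> by
      \<open>K * ev y q\<close>.\<close>
    have "ev y c \<le> ev y q" for y
    proof -
      have "(cmod (cinner y (bop_apply (h n) x)))\<^sup>2 \<le> K * ev y q" for n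
      proof -
        note b = bd[OF h(1)[of n]]
        have "(cmod (cinner y (bop_apply (h n) x)))\<^sup>2 \<le> ev y (h n) * ev x (h n)"
          using b by (intro nonneg_cauchy_schwarz) simp
        also have "\<dots> \<le> ev y q * K"
        proof (rule mult_mono)
          show "ev x (h n) \<le> K" using b ev_mono[of "h n" 1 x] by (simp add: K_def ev_one)
        qed (use b bd[OF q] in \<open>auto intro: ev_mono h(2) ev_nonneg\<close>)
        finally show ?thesis by (simp add: mult.commute)
      qed
      moreover have "(\<lambda>n. (cmod (cinner y (bop_apply (h n) x)))\<^sup>2) \<longlonglongrightarrow> (cmod (cinner y v))\<^sup>2"
        by (intro tendsto_intros bounded_linear.tendsto[OF bounded_linear_cinner_right h(3)])
      ultimately have "(cmod (cinner y v))\<^sup>2 \<le> K * ev y q" by (intro LIMSEQ_le_const2) auto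
      moreover have "cmod (cinner v y) = cmod (cinner y v)"
        by (subst cinner_commute) simp
      ultimately show ?thesis using K by (simp add: c_def ev_scaleR ev_rank1 field_simps)
    qed
    then show ?thesis using c0 bd[OF q] by (subst selfadjoint_le_iff) (auto simp: nonneg_selfadjoint)
  qed
  have "\<Phi> (onproj F) \<le> 1 - c" if "F \<in> ?Fs" for F
  proof -
    have "c \<le> ?q F" by (rule c_le) (use that in blast)
    then show ?thesis by (simp add: diff \<Phi>(3) algebra_simps)
  qed
  with lub[unfolded image_image] have "\<Phi> 1 \<le> 1 - c" by (rule isLub_UNIV_image_least)
  then have "ev v c \<le> 0" using ev_mono[of c 0 v] \<Phi>(3) by (simp add: algebra_simps)
  then show False using K \<open>v \<noteq> 0\<close> by (simp add: c_def ev_scaleR ev_rank1 cinner_self divide_le_0_iff)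
qed

section \<open>Completely positive maps\<close>

lemma sandwich_nonneg: "0 \<le> x \<Longrightarrow> 0 \<le> a * x * adj a"
  unfolding bop_nonneg_iff by (simp add: bop_rep_eqs cinner_adj[of a, symmetric])

lemma completely_positive_linear: "completely_positive \<Phi> \<Longrightarrow> complex_linear_map \<Phi>"
  by (simp add: completely_positive_def)

lemma completely_positive_nonneg:
  assumes "completely_positive \<Phi>" "0 \<le> a" shows "0 \<le> \<Phi> a"
proof -
  have "positive_matrix 1 (\<lambda>_ _. a)" using assms(2) by (simp add: positive_matrix_def bop_nonneg_iff)
  then have "positive_matrix 1 (\<lambda>_ _. \<Phi> a)"
    using assms(1)[unfolded completely_positive_def, THEN conjunct2, rule_format] by blast
  note this[unfolded positive_matrix_def, THEN spec, of "\<lambda>_. x" for x]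
  then show ?thesis by (simp add: bop_nonneg_iff)
qed

lemma completely_positive_mono:
  assumes "completely_positive \<Phi>" shows "mono \<Phi>"
proof (rule monoI)
  fix a b :: "'a bop" assume "a \<le> b"
  then have "0 \<le> \<Phi> (b - a)" by (intro completely_positive_nonneg[OF assms]) simp
  then show "\<Phi> a \<le> \<Phi> b"
    by (simp add: complex_linear_map_diff[OF completely_positive_linear[OF assms]])
qed

lemma completely_positive_sum:
  assumes "completely_positive \<Phi>" "positive_matrix n X"
  shows "(\<Sum>i<n. \<Sum>j<n. cinner (\<xi> i) (bop_apply (\<Phi> (X i j)) (\<xi> j))) \<in> \<real>\<^sub>\<ge>\<^sub>0"
proof -
  have "positive_matrix n (\<lambda>i j. \<Phi> (X i j))"
    using assms(1)[unfolded completely_positive_def, THEN conjunct2, rule_format] assms(2) by blast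
  then show ?thesis unfolding positive_matrix_def by blast
qed

lemma positive_matrix_gram: "positive_matrix n (\<lambda>i j. adj (v i) * v j)"
proof -
  have "(\<Sum>i<n. \<Sum>j<n. cinner (\<xi> i) (bop_apply (adj (v i) * v j) (\<xi> j)))
      = cinner (\<Sum>i<n. bop_apply (v i) (\<xi> i)) (\<Sum>j<n. bop_apply (v j) (\<xi> j))" for \<xi>
    by (subst cinner_sum_left) (simp add: cinner_sum_right bop_rep_eqs cinner_adj_right)
  then show ?thesis by (simp add: positive_matrix_def cinner_self del: of_real_power)
qed

lemma positive_matrix_rank1: "positive_matrix n (\<lambda>i j. rank1 (w i) (w j))"
proof -
  have "(\<Sum>i<n. \<Sum>j<n. cinner (\<xi> i) (bop_apply (rank1 (w i) (w j)) (\<xi> j))) \<in> \<real>\<^sub>\<ge>\<^sub>0" for \<xi>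
  proof -
    let ?s = "\<Sum>j<n. cinner (w j) (\<xi> j)"
    have "(\<Sum>i<n. \<Sum>j<n. cinner (\<xi> i) (bop_apply (rank1 (w i) (w j)) (\<xi> j)))
        = (\<Sum>i<n. \<Sum>j<n. cnj (cinner (w i) (\<xi> i)) * cinner (w j) (\<xi> j))"
      by (simp add: rank1.rep_eq cinner_scaleC_right mult.commute flip: cinner_commute)
    also have "\<dots> = cnj ?s * ?s" by (simp add: sum_product)
    also have "\<dots> = complex_of_real ((cmod ?s)\<^sup>2)" by (simp only: complex_norm_square mult.commute)
    finally show ?thesis by (simp del: of_real_power)
  qed
  then show ?thesis by (simp add: positive_matrix_def)
qed

text \<open>The 2 by 2 matrix of operators \<open>rank1 (w i) (w j)\<close> is positive, so
  \<open>cinner \<zeta> (bop_apply (\<Phi> (rank1 \<omega> \<xi>)) \<eta>)\<close> is a positive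
  semidefinite kernel in the pairs \<open>(\<zeta>, \<omega>)\<close> and
  \<open>(\<eta>, \<xi>)\<close>: the Choi form of \<Phi>.\<close>

lemma completely_positive_rank1:
  assumes "completely_positive \<Phi>"
  shows "cinner \<eta> (bop_apply (\<Phi> (rank1 \<xi> \<omega>)) \<zeta>) = cnj (cinner \<zeta> (bop_apply (\<Phi> (rank1 \<omega> \<xi>)) \<eta>))"
    and "(cmod (cinner \<zeta> (bop_apply (\<Phi> (rank1 \<omega> \<xi>)) \<eta>)))\<^sup>2
      \<le> ev \<zeta> (\<Phi> (rank1 \<omega> \<omega>)) * ev \<eta> (\<Phi> (rank1 \<xi> \<xi>))"
proof -
  define w where "w i = (if i = 0 then \<omega> else \<xi>)" for i :: nat
  have "cinner \<zeta> (bop_apply (\<Phi> (rank1 \<omega> \<omega>)) \<zeta>)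
      + t * cinner \<zeta> (bop_apply (\<Phi> (rank1 \<omega> \<xi>)) \<eta>) + cnj t * cinner \<eta> (bop_apply (\<Phi> (rank1 \<xi> \<omega>)) \<zeta>)
      + t * cnj t * cinner \<eta> (bop_apply (\<Phi> (rank1 \<xi> \<xi>)) \<eta>) \<in> \<real>\<^sub>\<ge>\<^sub>0" for t
    using completely_positive_sum[OF assms positive_matrix_rank1[of 2 w],
        of "\<lambda>i. if i = 0 then \<zeta> else t *\<^sub>C \<eta>"]
    by (simp add: numeral_2_eq_2 w_def bop_apply_scaleC cinner_scaleC_left cinner_scaleC_right
        algebra_simps)
  note q = nonneg_quadratic[OF this]
  show "cinner \<eta> (bop_apply (\<Phi> (rank1 \<xi> \<omega>)) \<zeta>) = cnj (cinner \<zeta> (bop_apply (\<Phi> (rank1 \<omega> \<xi>)) \<eta>))"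
    by (rule q(1))
  show "(cmod (cinner \<zeta> (bop_apply (\<Phi> (rank1 \<omega> \<xi>)) \<eta>)))\<^sup>2
      \<le> ev \<zeta> (\<Phi> (rank1 \<omega> \<omega>)) * ev \<eta> (\<Phi> (rank1 \<xi> \<xi>))"
    using q(2) by (simp add: ev_def)
qed

text \<open>
  Choi's multiplicative domain: the vector \<open>y \<otimes> \<zeta> - 1 \<otimes> y \<zeta>\<close> is null for the Stinespring form
  \<open>\<langle>a \<otimes> \<zeta>, b \<otimes> \<eta>\<rangle> = \<langle>\<zeta>, \<Phi> (a\<^sup>* b) \<eta>\<rangle>\<close>, hence orthogonal to every \<open>x \<otimes> \<eta>\<close>.
\<close>
lemma multiplicative_domain:
  fixes \<Phi> :: "'h::complex_hilbert_space bop \<Rightarrow> 'h bop"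
  assumes cp: "completely_positive \<Phi>" and one: "\<Phi> 1 = 1"
    and fixed: "\<Phi> y = y" "\<Phi> (adj y) = adj y" "\<Phi> (adj y * y) = adj y * y"
  shows "\<Phi> (adj y * x) = adj y * \<Phi> x" and "\<Phi> (adj x * y) = \<Phi> (adj x) * y"
proof -
  define v where "v i = (if i = 0 then y else if i = Suc 0 then 1 else x)" for i :: nat
  \<comment> \<open>The constant term is the squared length of the null vector: the four terms over
    the indices \<open>0\<close> and \<open>Suc 0\<close> cancel by \<open>fixed\<close> and
    \<open>one\<close>. Cauchy-Schwarz with this zero then kills the linear coefficient.\<close>
  have \<alpha>: "0 + t * (cinner \<zeta> (bop_apply (\<Phi> (adj y * x)) \<eta>) - cinner \<zeta> (bop_apply (adj y * \<Phi> x) \<eta>))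
      + cnj t * (cinner \<eta> (bop_apply (\<Phi> (adj x * y)) \<zeta>) - cinner \<eta> (bop_apply (\<Phi> (adj x) * y) \<zeta>))
      + t * cnj t * cinner \<eta> (bop_apply (\<Phi> (adj x * x)) \<eta>) \<in> \<real>\<^sub>\<ge>\<^sub>0" for t \<zeta> \<eta>
    using completely_positive_sum[OF cp positive_matrix_gram[of 3 v], of
        "\<lambda>i. if i = 0 then \<zeta> else if i = Suc 0 then - bop_apply y \<zeta> else t *\<^sub>C \<eta>"]
    by (simp add: numeral_3_eq_3 v_def bop_apply_scaleC cinner_scaleC_left cinner_scaleC_right
        bop_apply_minus cinner_minus_left cinner_minus_right fixed one bop_rep_eqs cinner_adj_right
        algebra_simps)
  note q = nonneg_quadratic[OF \<alpha>]
  have z: "cinner \<zeta> (bop_apply (\<Phi> (adj y * x)) \<eta>) - cinner \<zeta> (bop_apply (adj y * \<Phi> x) \<eta>) = 0" for \<zeta> \<eta>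
    using q(2)[of \<zeta> \<eta>] by simp
  show "\<Phi> (adj y * x) = adj y * \<Phi> x"
    by (rule bop_eqI, rule cinner_ext) (rule z[unfolded right_minus_eq])
  have "cinner \<eta> (bop_apply (\<Phi> (adj x * y)) \<zeta>) - cinner \<eta> (bop_apply (\<Phi> (adj x) * y) \<zeta>) = 0" for \<zeta> \<eta>
    unfolding q(1)[of \<eta> \<zeta>] z by simp
  then show "\<Phi> (adj x * y) = \<Phi> (adj x) * y"
    by - (rule bop_eqI, rule cinner_ext, simp only: right_minus_eq)
qed

text \<open>
  In a Kraus decomposition \<open>\<Phi> x = (\<Sum>k. a\<^sub>k\<^sup>* x a\<^sub>k)\<close> one has
  \<open>D = (\<Sum>k. \<langle>\<xi>, a\<^sub>k \<eta>\<rangle> a\<^sub>k\<^sup>*)\<close>. Subtracting \<open>D x D\<^sup>* / \<langle>\<eta>, D \<xi>\<rangle>\<close> from \<open>\<Phi>\<close> is a Gram-Schmidt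
  step on the Kraus operators. If \<open>\<langle>\<eta>, D \<xi>\<rangle> = 0\<close>, then nothing is subtracted, as \<open>1 / 0 = 0\<close>.
\<close>
lemma completely_positive_peel:
  fixes \<Phi> :: "'h::complex_hilbert_space bop \<Rightarrow> 'h bop" and \<xi> \<eta> :: 'h
  assumes cp: "completely_positive \<Phi>"
  defines "c \<equiv> 1 / ev \<eta> (\<Phi> (rank1 \<xi> \<xi>))"
  obtains D where "\<And>\<omega>. bop_apply D \<omega> = bop_apply (\<Phi> (rank1 \<omega> \<xi>)) \<eta>"
    "completely_positive (\<lambda>x. \<Phi> x - c *\<^sub>R (D * x * adj D))"
    "ev \<eta> (\<Phi> (rank1 \<xi> \<xi>) - c *\<^sub>R (D * rank1 \<xi> \<xi> * adj D)) = 0"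
proof -
  define F where "F = ev \<eta> (\<Phi> (rank1 \<xi> \<xi>))"
  note lin = completely_positive_linear[OF cp]
  have scale: "\<Phi> (z *\<^sub>C a) = z *\<^sub>C \<Phi> a" for z a using lin by (simp add: complex_linear_map_def)
  have F0: "F \<ge> 0" unfolding F_def by (intro ev_nonneg completely_positive_nonneg[OF cp] rank1_nonneg)
  have F: "cinner \<eta> (bop_apply (\<Phi> (rank1 \<xi> \<xi>)) \<eta>) = complex_of_real F"
    unfolding F_def
    by (intro cinner_nonneg_eq_ev completely_positive_nonneg[OF cp] rank1_nonneg)
  define d where "d \<omega> = bop_apply (\<Phi> (rank1 \<omega> \<xi>)) \<eta>" for \<omega>
  have d_add: "d (a + b) = d a + d b" for a b
    by (simp add: d_def rank1_add_left complex_linear_map_add[OF lin] bop_rep_eqs)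
  have d_scale: "d (z *\<^sub>C a) = z *\<^sub>C d a" for z a
    by (simp add: d_def rank1_scaleC_left scale bop_rep_eqs)
  \<comment> \<open>The map need not be unital, since remainders are peeled again; a scalar bound on
    \<open>\<Phi> 1\<close> takes the place of unitality.\<close>
  obtain K where K: "K > 0" "\<Phi> 1 \<le> K *\<^sub>R 1"
    using selfadjoint_le_scaleR[of "\<Phi> 1"] nonneg_selfadjoint(1)
      completely_positive_nonneg[OF cp bop_one_nonneg] by blast
  \<comment> \<open>Cauchy-Schwarz with \<open>\<zeta> = d \<omega>\<close> bounds the fourth power
    of \<open>norm (d \<omega>)\<close> by its square times
    \<open>(norm \<omega>)\<^sup>2 * (K * F)\<close>; one square cancels.\<close>
  have d_bound: "norm (d \<omega>) \<le> norm \<omega> * sqrt (K * F)" for \<omega>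
  proof (cases "d \<omega> = 0")
    case False
    have "rank1 \<omega> \<omega> \<le> (norm \<omega>)\<^sup>2 *\<^sub>R 1"
    proof (subst selfadjoint_le_iff)
      show "\<forall>x. ev x (rank1 \<omega> \<omega>) \<le> ev x ((norm \<omega>)\<^sup>2 *\<^sub>R 1)"
        using cmod_cinner_le[of \<omega>]
        by (auto simp: ev_rank1 ev_scaleR ev_one simp flip: power_mult_distrib intro!: power_mono)
    qed (simp_all add: nonneg_selfadjoint rank1_nonneg scaleR_scaleC adj_scaleC)
    then have "\<Phi> (rank1 \<omega> \<omega>) \<le> \<Phi> ((norm \<omega>)\<^sup>2 *\<^sub>R 1)" by (rule monoD[OF completely_positive_mono[OF cp]])
    also have "\<dots> \<le> (norm \<omega>)\<^sup>2 *\<^sub>R K *\<^sub>R 1"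
      unfolding scaleR_scaleC[of "(norm \<omega>)\<^sup>2"] scale
      unfolding scaleR_scaleC[of "(norm \<omega>)\<^sup>2", symmetric] by (intro scaleR_left_mono K(2)) simp
    finally have "\<Phi> (rank1 \<omega> \<omega>) \<le> (norm \<omega>)\<^sup>2 *\<^sub>R K *\<^sub>R 1" .
    from ev_mono[OF this] have le: "ev x (\<Phi> (rank1 \<omega> \<omega>)) \<le> (norm \<omega>)\<^sup>2 * (K * (norm x)\<^sup>2)" for x
      by (simp add: ev_scaleR ev_one mult.assoc)
    have "(norm (d \<omega>))\<^sup>2 * (norm (d \<omega>))\<^sup>2 = (cmod (cinner (d \<omega>) (d \<omega>)))\<^sup>2"
      by (simp add: cinner_self norm_power flip: power2_eq_square)
    also have "\<dots> \<le> ev (d \<omega>) (\<Phi> (rank1 \<omega> \<omega>)) * F"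
      unfolding F_def by (subst (2) d_def) (rule completely_positive_rank1(2)[OF cp])
    also have "\<dots> \<le> (norm \<omega>)\<^sup>2 * (K * (norm (d \<omega>))\<^sup>2) * F"
      by (rule mult_right_mono[OF le F0])
    finally have "(norm (d \<omega>))\<^sup>2 * (norm (d \<omega>))\<^sup>2 \<le> (norm (d \<omega>))\<^sup>2 * ((norm \<omega>)\<^sup>2 * (K * F))"
      by (simp only: mult_ac)
    then have "(norm (d \<omega>))\<^sup>2 \<le> (norm \<omega>)\<^sup>2 * (K * F)"
      using False by (subst (asm) mult_le_cancel_left_pos) auto
    then have "sqrt ((norm (d \<omega>))\<^sup>2) \<le> sqrt ((norm \<omega>)\<^sup>2 * (K * F))" by (rule real_sqrt_le_mono)
    then show ?thesis by (simp add: real_sqrt_mult)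
  qed (use K(1) F0 in simp)
  define D where "D = Bop d"
  have D: "bop_apply D \<omega> = d \<omega>" for \<omega>
  proof -
    have "bounded_linear d"
      by (rule bounded_linear_intro[where K = "sqrt (K * F)"])
        (simp_all add: d_add d_scale scaleR_scaleC d_bound)
    then show ?thesis by (simp add: D_def Bop_inverse d_scale)
  qed
  define R where "R x = \<Phi> x - c *\<^sub>R (D * x * adj D)" for x
  have c: "c = 1 / F" by (simp add: c_def F_def)
  have "complex_linear_map R"
    unfolding complex_linear_map_def R_def using lin
    by (simp add: complex_linear_map_def algebra_simps scaleC_bop_mult_left scaleC_bop_mult_right
        scaleC_diff_right scaleR_scaleC scaleC_scaleC scaleC_add_right)
  moreover have "positive_matrix n (\<lambda>i j. R (X i j))" if X: "positive_matrix n X" for n X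
    unfolding positive_matrix_def
  proof
    fix v :: "nat \<Rightarrow> 'h"
    define q where "q u u' = (\<Sum>i<n. \<Sum>j<n. cinner (u i) (bop_apply (X i j) (u' j)))" for u u'
    have q_nonneg: "q u u \<in> \<real>\<^sub>\<ge>\<^sub>0" for u using X by (simp add: positive_matrix_def q_def)
    have q_expand: "q (\<lambda>i. u i + t *\<^sub>C u' i) (\<lambda>i. u i + t *\<^sub>C u' i)
        = q u u + t * q u u' + cnj t * q u' u + t * cnj t * q u' u'" for u u' t
      by (simp add: q_def bop_apply_add bop_apply_scaleC cinner_add_left cinner_add_right
          cinner_scaleC_left cinner_scaleC_right sum.distrib sum_distrib_left algebra_simps)
    have q_herm: "q u' u = cnj (q u u')" for u u'
    proof (rule nonneg_quadratic(1))
      show "q u u + t * q u u' + cnj t * q u' u + t * cnj t * q u' u' \<in> \<real>\<^sub>\<ge>\<^sub>0" for t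
        using q_nonneg[of "\<lambda>i. u i + t *\<^sub>C u' i"] unfolding q_expand .
    qed
    \<comment> \<open>\<open>q w w\<close> is the contribution of
      \<open>x \<mapsto> D * x * adj D\<close> at the test vectors \<open>v\<close>. The aim is to
      exhibit the form of \<open>R\<close> at \<open>v\<close> as the form of \<Phi> on an enlarged
      positive matrix.\<close>
    define w where "w i = bop_apply (adj D) (v i)" for i
    define Xw where "Xw i = (\<Sum>j<n. bop_apply (X i j) (w j))" for i
    \<comment> \<open>\<open>M\<close> pulls \<open>q\<close> back along \<open>u \<mapsto>
      (\<lambda>i. u i + cinner \<xi> (u n) *\<^sub>C w i)\<close> and is therefore positive. Its
      border consists of rank-one operators, on which \<Phi> is expressed through
      \<open>D\<close>.\<close>
    define M where "M i j = (if i < n then if j < n then X i j else rank1 (Xw i) \<xi>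
      else if j < n then rank1 \<xi> (Xw j) else q w w *\<^sub>C rank1 \<xi> \<xi>)" for i j
    have q_Xw: "(\<Sum>i<n. cinner (u i) (Xw i)) = q u w" for u
      by (simp add: q_def Xw_def cinner_sum_right)
    have q_Xw': "(\<Sum>i<n. cinner (Xw i) (u i)) = q w u" for u
    proof -
      have "(\<Sum>i<n. cinner (Xw i) (u i)) = cnj (\<Sum>i<n. cinner (u i) (Xw i))"
        by (simp flip: cinner_commute)
      then show ?thesis by (simp add: q_Xw flip: q_herm)
    qed
    have M: "positive_matrix (Suc n) M"
      unfolding positive_matrix_def
    proof
      fix u :: "nat \<Rightarrow> 'h"
      let ?l = "cinner \<xi> (u n)"
      have "(\<Sum>i<Suc n. \<Sum>j<Suc n. cinner (u i) (bop_apply (M i j) (u j)))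
        = q u u + (\<Sum>i<n. ?l * cinner (u i) (Xw i)) + (\<Sum>j<n. cinner (u n) \<xi> * cinner (Xw j) (u j))
          + ?l * cinner (u n) \<xi> * q w w"
        by (simp add: M_def q_def sum.distrib rank1.rep_eq scaleC_bop.rep_eq cinner_scaleC_right
            mult_ac)
      also have "\<dots> = q (\<lambda>i. u i + ?l *\<^sub>C w i) (\<lambda>i. u i + ?l *\<^sub>C w i)"
        unfolding q_expand sum_distrib_left[symmetric] q_Xw q_Xw' cinner_commute[of "u n" \<xi>] ..
      finally show "(\<Sum>i<Suc n. \<Sum>j<Suc n. cinner (u i) (bop_apply (M i j) (u j))) \<in> \<real>\<^sub>\<ge>\<^sub>0"
        using q_nonneg by simp
    qed
    let ?Q = "\<Sum>i<n. \<Sum>j<n. cinner (v i) (bop_apply (\<Phi> (X i j)) (v j))"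
    \<comment> \<open>With last entry \<open>- s *\<^sub>C \<eta>\<close> for real \<open>s\<close>,
      the form is \<open>?Q - 2 * s * q w w + s\<^sup>2 * F * q w w\<close>. For
      \<open>F > 0\<close> and real \<open>q w w \<ge> 0\<close>, the choice
      \<open>s = 1 / F = c\<close> is optimal; for \<open>F = 0\<close> the value is
      \<open>?Q\<close>, as \<open>c = 0\<close>.\<close>
    let ?v = "v(n := complex_of_real (- c) *\<^sub>C \<eta>)"
    have t1: "(\<Sum>i<n. cinner (v i) (bop_apply (\<Phi> (rank1 (Xw i) \<xi>)) \<eta>)) = q w w"
      by (simp add: w_def cinner_adj D d_def flip: q_Xw)
    have t2: "(\<Sum>j<n. cinner \<eta> (bop_apply (\<Phi> (rank1 \<xi> (Xw j))) (v j))) = q w w"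
    proof -
      have "(\<Sum>j<n. cinner \<eta> (bop_apply (\<Phi> (rank1 \<xi> (Xw j))) (v j))) = cnj (q w w)"
        unfolding t1[symmetric] cnj_sum by (intro sum.cong refl completely_positive_rank1(1)[OF cp])
      then show ?thesis by (simp flip: q_herm)
    qed
    have "(\<Sum>i<Suc n. \<Sum>j<Suc n. cinner (?v i) (bop_apply (\<Phi> (M i j)) (?v j)))
      = ?Q - c * q w w - c * q w w + c * c * F * q w w"
    proof -
      have "(\<Sum>i<Suc n. \<Sum>j<Suc n. cinner (?v i) (bop_apply (\<Phi> (M i j)) (?v j)))
        = ?Q + (\<Sum>i<n. - c * cinner (v i) (bop_apply (\<Phi> (rank1 (Xw i) \<xi>)) \<eta>))
          + (\<Sum>j<n. - c * cinner \<eta> (bop_apply (\<Phi> (rank1 \<xi> (Xw j))) (v j)))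
          + c * c * q w w * cinner \<eta> (bop_apply (\<Phi> (rank1 \<xi> \<xi>)) \<eta>)"
        by (simp add: M_def sum.distrib sum_subtractf sum_negf scale scaleC_bop.rep_eq bop_apply_scaleC
            cinner_scaleC_left cinner_scaleC_right mult_ac)
      then show ?thesis unfolding F sum_distrib_left[symmetric] t1 t2 by (simp add: mult_ac)
    qed
    also have "\<dots> = ?Q - c * q w w" by (simp add: c)
    also have "\<dots> = (\<Sum>i<n. \<Sum>j<n. cinner (v i) (bop_apply (R (X i j)) (v j)))"
      by (simp add: R_def q_def w_def bop_rep_eqs scaleR_scaleC cinner_diff_right cinner_scaleC_right
          sum_subtractf sum_distrib_left cinner_adj)
    finally show "(\<Sum>i<n. \<Sum>j<n. cinner (v i) (bop_apply (R (X i j)) (v j))) \<in> \<real>\<^sub>\<ge>\<^sub>0"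
      using completely_positive_sum[OF cp M, of ?v] by metis
  qed
  ultimately have "completely_positive R" by (simp add: completely_positive_def)
  moreover have "ev \<eta> (R (rank1 \<xi> \<xi>)) = 0"
  proof -
    have "cinner \<xi> (bop_apply (adj D) \<eta>) = F"
      using F by (subst cinner_commute) (simp add: cinner_adj D d_def)
    then have "ev \<eta> (D * rank1 \<xi> \<xi> * adj D) = F * F"
      using F by (simp add: ev_def bop_rep_eqs rank1.rep_eq bop_apply_scaleC cinner_scaleC_right D d_def)
    then show ?thesis by (simp add: R_def ev_diff ev_scaleR c flip: F_def)
  qed
  ultimately show ?thesis using that[of D] D by (simp add: R_def[abs_def] d_def)
qed

section \<open>Module maps over commuting algebras\<close>

text \<open>Induction on \<open>S\<close>, one peeling per pair. Left linearity over
  \<open>N\<close> is carried along because it puts the next \<open>D\<close> into the commutant of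
  \<open>N\<close>. Each step only decreases the remainder on positive operators, so expectations
  that are already zero stay zero. The last clause records the effect of the removed Kraus terms
  without naming their sum.\<close>

lemma completely_positive_peel_finite:
  fixes \<Phi> \<Theta> :: "'h::complex_hilbert_space bop \<Rightarrow> 'h bop"
  assumes cp: "completely_positive \<Phi>" and module: "\<And>y x. y \<in> N \<Longrightarrow> \<Phi> (y * x) = y * \<Phi> x"
    and \<Theta>: "complex_linear_map \<Theta>"
      "\<And>d x. d \<in> commutant N \<Longrightarrow> \<Theta> (d * x * adj d) = d * \<Theta> x * adj d"
    and fin: "finite S"
  shows "\<exists>R. completely_positive R \<and> (\<forall>y\<in>N. \<forall>x. R (y * x) = y * R x) \<and> (\<forall>x\<ge>0. R x \<le> \<Phi> x) \<and>
    (\<forall>(\<xi>, \<eta>)\<in>S. ev \<eta> (R (rank1 \<xi> \<xi>)) = 0) \<and> (\<forall>x. \<Theta> (\<Phi> x - R x) = \<Phi> (\<Theta> x) - R (\<Theta> x))"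
  using fin
proof induction
  case empty
  show ?case
    by (rule exI[of _ \<Phi>]) (simp add: cp module complex_linear_map_zero[OF \<Theta>(1)])
next
  case (insert p S)
  obtain \<xi> \<eta> where p: "p = (\<xi>, \<eta>)" by (cases p)
  from insert.IH obtain R where R: "completely_positive R" and "\<forall>y\<in>N. \<forall>x. R (y * x) = y * R x"
    and "\<forall>x\<ge>0. R x \<le> \<Phi> x" and "\<forall>(\<xi>, \<eta>)\<in>S. ev \<eta> (R (rank1 \<xi> \<xi>)) = 0"
    and "\<forall>x. \<Theta> (\<Phi> x - R x) = \<Phi> (\<Theta> x) - R (\<Theta> x)"
    by (elim exE conjE) (rule that; assumption)
  note R = R this(2)[rule_format] this(3)[rule_format] this(4)[THEN bspec, of "(\<xi>, \<eta>)" for \<xi> \<eta>, unfolded prod.case]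
    this(5)[rule_format]
  define c where "c = 1 / ev \<eta> (R (rank1 \<xi> \<xi>))"
  obtain D where D: "\<And>\<omega>. bop_apply D \<omega> = bop_apply (R (rank1 \<omega> \<xi>)) \<eta>"
    and cp': "completely_positive (\<lambda>x. R x - c *\<^sub>R (D * x * adj D))"
    and z: "ev \<eta> (R (rank1 \<xi> \<xi>) - c *\<^sub>R (D * rank1 \<xi> \<xi> * adj D)) = 0"
    by (rule completely_positive_peel[OF R(1), of \<xi> \<eta>, folded c_def]) (rule that; assumption)
  define R' where "R' x = R x - c *\<^sub>R (D * x * adj D)" for x
  have c0: "0 \<le> c"
    unfolding c_def by (intro divide_nonneg_nonneg ev_nonneg completely_positive_nonneg[OF R(1)] rank1_nonneg) simp
  \<comment> \<open>The argument of \<open>D\<close> occupies the left slot of a rank-one operator,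
    where \<open>y\<close> can be pulled out of \<open>R\<close>.\<close>
  have Dy: "D * y = y * D" if "y \<in> N" for y
    by (rule bop_eqI) (simp add: times_bop.rep_eq D R(2)[OF that] flip: mult_rank1)
  have "D \<in> commutant N" using Dy by (simp add: commutant_def)
  note \<Theta>D = \<Theta>(2)[OF this]
  have le: "R' x \<le> R x" if "0 \<le> x" for x
    using that c0 by (simp add: R'_def sandwich_nonneg scaleR_nonneg_nonneg)
  have cpR': "completely_positive R'" using cp' by (simp add: R'_def[abs_def])
  have "ev \<eta>' (R' (rank1 \<xi>' \<xi>')) = 0" if "(\<xi>', \<eta>') \<in> insert p S" for \<xi>' \<eta>'
  proof (cases "(\<xi>', \<eta>') = p")
    case True
    then show ?thesis using z by (simp add: p R'_def)
  next
    case False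
    have "0 \<le> ev \<eta>' (R' (rank1 \<xi>' \<xi>'))"
      by (intro ev_nonneg completely_positive_nonneg[OF cpR'] rank1_nonneg)
    moreover have "ev \<eta>' (R' (rank1 \<xi>' \<xi>')) \<le> ev \<eta>' (R (rank1 \<xi>' \<xi>'))"
      by (intro ev_mono le rank1_nonneg)
    ultimately show ?thesis using R(4)[of \<xi>' \<eta>'] that False by simp
  qed
  moreover have "R' (y * x) = y * R' x" if y: "y \<in> N" for x y
  proof -
    have "D * (y * x) * adj D = y * (D * x * adj D)" using Dy[OF y] by (metis mult.assoc)
    then show ?thesis
      by (simp add: R'_def R(2)[OF y] right_diff_distrib scaleR_scaleC scaleC_bop_mult_right)
  qed
  moreover have "R' x \<le> \<Phi> x" if "0 \<le> x" for x
    using le[OF that] R(3)[OF that] by (rule order_trans)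
  moreover have "\<Theta> (\<Phi> x - R' x) = \<Phi> (\<Theta> x) - R' (\<Theta> x)" for x
  proof -
    have "\<Theta> (\<Phi> x - R' x) = \<Theta> (\<Phi> x - R x) + \<Theta> (complex_of_real c *\<^sub>C (D * x * adj D))"
      unfolding complex_linear_map_add[OF \<Theta>(1), symmetric]
      by (rule arg_cong[of _ _ \<Theta>]) (simp add: R'_def scaleR_scaleC)
    also have "\<Theta> (complex_of_real c *\<^sub>C (D * x * adj D)) = c *\<^sub>R (D * \<Theta> x * adj D)"
      using \<Theta>(1) by (simp only: complex_linear_map_def \<Theta>D scaleR_scaleC)
    finally show ?thesis by (simp add: R(5) R'_def)
  qed
  ultimately show ?case using cpR' by (intro exI[of _ R']) auto
qed

text \<open>
  Up to a small completely positive remainder \<open>R\<close>, the map \<open>\<Phi>\<close> is a finite sum of maps \<open>x \<mapsto> d x d\<^sup>*\<close>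
  with \<open>d\<close> in the commutant of \<open>N\<close>, and these commute with \<open>\<Theta>\<close>. The finite set of
  pairs at which \<open>R\<close> is made to vanish is chosen, by normality of \<open>\<Phi>\<close>, \<open>\<Theta>\<close> and \<open>\<Theta> \<circ> \<Phi>\<close>, such that
  both \<open>R \<circ> \<Theta>\<close> and \<open>\<Theta> \<circ> R\<close> are small at the given vector.
\<close>
lemma normal_ucp_module_commute:
  fixes \<Phi> \<Theta> :: "'h::complex_hilbert_space bop \<Rightarrow> 'h bop"
  assumes \<Phi>: "normal_ucp \<Phi>" and module: "\<And>y x. y \<in> N \<Longrightarrow> \<Phi> (y * x) = y * \<Phi> x"
    and \<Theta>: "normal_ucp \<Theta>"
      "\<And>d x. d \<in> commutant N \<Longrightarrow> \<Theta> (d * x * adj d) = d * \<Theta> x * adj d"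
  shows "\<Phi> \<circ> \<Theta> = \<Theta> \<circ> \<Phi>"
proof -
  have cp: "completely_positive \<Phi>" "completely_positive \<Theta>"
    and one: "\<Phi> 1 = 1" "\<Theta> 1 = 1" and normal: "normal_map \<Phi>" "normal_map \<Theta>"
    using \<Phi> \<Theta> by (simp_all add: normal_ucp_def)
  note lin = cp[THEN completely_positive_linear]
  note mono = cp[THEN completely_positive_mono, THEN monoD]
  note pos = cp[THEN completely_positive_nonneg]
  obtain B :: "'h set" where B: "orthonormal B" "\<And>x. (\<And>e. e \<in> B \<Longrightarrow> cinner e x = 0) \<Longrightarrow> x = 0"
    using ex_complete_orthonormal by blast
  have close: "\<bar>ev \<eta> (\<Phi> (\<Theta> x)) - ev \<eta> (\<Theta> (\<Phi> x))\<bar> < \<epsilon>" if x: "0 \<le> x" and \<epsilon>: "0 < \<epsilon>" for x \<eta> \<epsilon>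
  proof -
    obtain K where K: "K > 0" "x \<le> K *\<^sub>R 1"
      using selfadjoint_le_scaleR[OF nonneg_selfadjoint(1)[OF x]] by blast
    \<comment> \<open>Chosen for the final bounds \<open>K * \<delta> = \<epsilon> / 2\<close> on
      \<open>R (\<Theta> x)\<close> and \<open>K * (2 * \<delta>) = \<epsilon>\<close> on
      \<open>\<Theta> (R x)\<close>. Both expectations are nonnegative, so their difference stays
      below \<epsilon> without adding the bounds.\<close>
    define \<delta> where "\<delta> = \<epsilon> / (2 * K)"
    have \<delta>: "0 < \<delta>" using K \<epsilon> by (simp add: \<delta>_def)
    have lin': "complex_linear_map (\<Theta> \<circ> \<Phi>)" using lin by (simp add: complex_linear_map_def)
    have normal': "normal_map (\<Theta> \<circ> \<Phi>)"
      using normal pos(1) completely_positive_mono[OF cp(1)] by (intro normal_map_comp)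
    have mono': "mono (\<Theta> \<circ> \<Phi>)" using mono by (simp add: mono_def)
    obtain F1 where F1: "finite F1" "F1 \<subseteq> B" "ev \<eta> (\<Phi> (1 - onproj F1)) < \<delta>"
      using normal_onproj_small[OF B lin(1) normal(1) one(1) completely_positive_mono[OF cp(1)] \<delta>] by blast
    obtain F2 where F2: "finite F2" "F2 \<subseteq> B" "ev \<eta> (\<Theta> (1 - onproj F2)) < \<delta>"
      using normal_onproj_small[OF B lin(2) normal(2) one(2) completely_positive_mono[OF cp(2)] \<delta>] by blast
    obtain F3 where F3: "finite F3" "F3 \<subseteq> B" "ev \<eta> (\<Theta> (\<Phi> (1 - onproj F3))) < \<delta>"
      using normal_onproj_small[OF B lin' normal' _ mono' \<delta>] one by auto
    define F where "F = F1 \<union> F2 \<union> F3"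
    have F: "finite F" "orthonormal F"
      using F1 F2 F3 orthonormal_subset[OF B(1)] by (auto simp: F_def)
    let ?p = "onproj F"
    have p_le: "onproj F1 \<le> ?p" "onproj F2 \<le> ?p" "onproj F3 \<le> ?p"
      using F(1) by (auto simp: F_def intro: onproj_mono)
    have small: "ev \<eta> (\<Phi> (1 - ?p)) < \<delta>" "ev \<eta> (\<Theta> (1 - ?p)) < \<delta>" "ev \<eta> (\<Theta> (\<Phi> (1 - ?p))) < \<delta>"
    proof -
      have "ev \<eta> (\<Phi> (1 - ?p)) \<le> ev \<eta> (\<Phi> (1 - onproj F1))"
        by (intro ev_mono mono diff_left_mono p_le)
      moreover have "ev \<eta> (\<Theta> (1 - ?p)) \<le> ev \<eta> (\<Theta> (1 - onproj F2))"
        by (intro ev_mono mono diff_left_mono p_le)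
      moreover have "ev \<eta> (\<Theta> (\<Phi> (1 - ?p))) \<le> ev \<eta> (\<Theta> (\<Phi> (1 - onproj F3)))"
        by (intro ev_mono mono diff_left_mono p_le)
      ultimately show "ev \<eta> (\<Phi> (1 - ?p)) < \<delta>" "ev \<eta> (\<Theta> (1 - ?p)) < \<delta>" "ev \<eta> (\<Theta> (\<Phi> (1 - ?p))) < \<delta>"
        using F1(3) F2(3) F3(3) by linarith+
    qed
    obtain R where R: "completely_positive R" "\<And>x. 0 \<le> x \<Longrightarrow> R x \<le> \<Phi> x"
      "\<And>\<xi> \<eta>'. \<xi> \<in> F \<Longrightarrow> \<eta>' \<in> insert \<eta> F \<Longrightarrow> ev \<eta>' (R (rank1 \<xi> \<xi>)) = 0"
      "\<And>x. \<Theta> (\<Phi> x - R x) = \<Phi> (\<Theta> x) - R (\<Theta> x)"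
    proof -
      have "finite (F \<times> insert \<eta> F)" using F(1) by simp
      then have "\<exists>R. completely_positive R \<and> (\<forall>y\<in>N. \<forall>x. R (y * x) = y * R x) \<and> (\<forall>x\<ge>0. R x \<le> \<Phi> x) \<and>
        (\<forall>(\<xi>, \<eta>)\<in>F \<times> insert \<eta> F. ev \<eta> (R (rank1 \<xi> \<xi>)) = 0) \<and>
        (\<forall>x. \<Theta> (\<Phi> x - R x) = \<Phi> (\<Theta> x) - R (\<Theta> x))"
        using module \<Theta>(2) by (intro completely_positive_peel_finite cp(1) lin(2))
      then obtain R where "completely_positive R" "\<forall>x\<ge>0. R x \<le> \<Phi> x"
        "\<forall>(\<xi>, \<eta>)\<in>F \<times> insert \<eta> F. ev \<eta> (R (rank1 \<xi> \<xi>)) = 0"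
        "\<forall>x. \<Theta> (\<Phi> x - R x) = \<Phi> (\<Theta> x) - R (\<Theta> x)"
        by (elim exE conjE)
      then show ?thesis by (intro that[of R]) auto
    qed
    note linR = completely_positive_linear[OF R(1)]
    note posR = completely_positive_nonneg[OF R(1)]
    note monoR = monoD[OF completely_positive_mono[OF R(1)]]
    have scaleR: "\<Psi> (K *\<^sub>R a) = K *\<^sub>R \<Psi> a" if "complex_linear_map \<Psi>" for \<Psi> :: "'h bop \<Rightarrow> 'h bop" and a
      using that by (simp add: complex_linear_map_def scaleR_scaleC)
    have q0: "0 \<le> 1 - ?p" using onproj_le_one[OF F] by simp
    have split: "R 1 = R (1 - ?p) + R ?p" by (simp flip: complex_linear_map_add[OF linR])
    have evRp: "ev \<zeta> (R ?p) = 0" if "\<zeta> \<in> insert \<eta> F" for \<zeta>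
      using R(3) that by (simp add: onproj_def complex_linear_map_sum[OF linR] ev_sum)
    \<comment> \<open>Zero expectations on \<open>F\<close> make the effect \<open>R ?p\<close>
      annihilate \<open>F\<close>, by \<open>norm_sq_le_ev\<close>; this yields an inequality to
      which \<Theta> can be applied.\<close>
    have Rp: "R ?p \<le> 1 - ?p"
    proof (rule le_one_minus_onproj[OF F])
      show Rp0: "0 \<le> R ?p" by (intro posR onproj_nonneg)
      have "R ?p \<le> \<Phi> ?p" by (intro R(2) onproj_nonneg)
      also have "\<dots> \<le> \<Phi> 1" by (intro mono onproj_le_one F)
      finally show Rp1: "R ?p \<le> 1" by (simp add: one)
      show "bop_apply (R ?p) e = 0" if "e \<in> F" for e
        using norm_sq_le_ev[OF Rp0 Rp1, of e] evRp[of e] that by simp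
    qed
    \<comment> \<open>At \<eta> the part \<open>R ?p\<close> contributes nothing, because \<eta> was
      included among the prescribed vectors.\<close>
    have "ev \<eta> (R 1) < \<delta>"
      using ev_mono[OF R(2)[OF q0], of \<eta>] small(1) evRp[of \<eta>] by (simp add: split ev_add)
    moreover have "ev \<eta> (R (\<Theta> x)) \<le> K * ev \<eta> (R 1)"
    proof -
      have "R (\<Theta> x) \<le> R (\<Theta> (K *\<^sub>R 1))" by (intro monoR mono K)
      then show ?thesis using ev_mono by (fastforce simp: scaleR lin linR one ev_scaleR)
    qed
    ultimately have 1: "ev \<eta> (R (\<Theta> x)) < K * \<delta>" using K(1) by (meson le_less_trans mult_strict_left_mono)
    have "ev \<eta> (\<Theta> (R 1)) < 2 * \<delta>"
    proof -
      have "ev \<eta> (\<Theta> (R (1 - ?p))) \<le> ev \<eta> (\<Theta> (\<Phi> (1 - ?p)))" by (intro ev_mono mono R(2) q0)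
      moreover have "ev \<eta> (\<Theta> (R ?p)) \<le> ev \<eta> (\<Theta> (1 - ?p))" by (intro ev_mono mono Rp)
      ultimately show ?thesis
        using small by (simp add: split complex_linear_map_add[OF lin(2)] ev_add)
    qed
    moreover have "ev \<eta> (\<Theta> (R x)) \<le> K * ev \<eta> (\<Theta> (R 1))"
    proof -
      have "\<Theta> (R x) \<le> \<Theta> (R (K *\<^sub>R 1))" by (intro monoR mono K)
      then show ?thesis using ev_mono by (fastforce simp: scaleR lin linR one ev_scaleR)
    qed
    ultimately have 2: "ev \<eta> (\<Theta> (R x)) < K * (2 * \<delta>)" using K(1) by (meson le_less_trans mult_strict_left_mono)
    have "ev \<eta> (\<Theta> (\<Phi> x)) - ev \<eta> (\<Theta> (R x)) = ev \<eta> (\<Phi> (\<Theta> x)) - ev \<eta> (R (\<Theta> x))"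
      using arg_cong[OF R(4)[of x], of "ev \<eta>"] by (simp add: complex_linear_map_diff[OF lin(2)] ev_diff)
    moreover have "0 \<le> ev \<eta> (\<Theta> (R x))" "0 \<le> ev \<eta> (R (\<Theta> x))"
      using x by (auto intro: ev_nonneg pos posR)
    moreover have "K * \<delta> = \<epsilon> / 2" "K * (2 * \<delta>) = \<epsilon>" using K(1) by (simp_all add: \<delta>_def)
    ultimately show ?thesis using 1 2 \<epsilon> by linarith
  qed
  have nonneg_case: "\<Phi> (\<Theta> x) = \<Theta> (\<Phi> x)" if x: "0 \<le> x" for x
  proof (rule nonneg_eqI)
    show "ev \<eta> (\<Phi> (\<Theta> x)) = ev \<eta> (\<Theta> (\<Phi> x))" for \<eta>
    proof (rule ccontr)
      assume "ev \<eta> (\<Phi> (\<Theta> x)) \<noteq> ev \<eta> (\<Theta> (\<Phi> x))"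
      then show False
        using close[OF x, of "\<bar>ev \<eta> (\<Phi> (\<Theta> x)) - ev \<eta> (\<Theta> (\<Phi> x))\<bar>" \<eta>] by simp
    qed
  qed (use x pos in auto)
  have selfadjoint_case: "\<Phi> (\<Theta> h) = \<Theta> (\<Phi> h)" if "adj h = h" for h
  proof -
    have "adj (- h) = - h" using adj_diff[of 0 h] that by (metis adj_eqI cinner_zero_left cinner_zero_right diff_0 zero_bop.rep_eq)
    then obtain K where K: "- h \<le> K *\<^sub>R 1" using selfadjoint_le_scaleR by blast
    then have "0 \<le> K *\<^sub>R 1 + h" by (metis diff_ge_0_iff_ge diff_minus_eq_add)
    note nonneg_case[OF this]
    moreover have "\<Phi> (K *\<^sub>R 1) = K *\<^sub>R 1" "\<Theta> (K *\<^sub>R 1) = K *\<^sub>R 1"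
      using lin one by (simp_all add: scaleR_scaleC complex_linear_map_def)
    ultimately show ?thesis by (simp add: lin[THEN complex_linear_map_add])
  qed
  show ?thesis
  proof
    fix a :: "'h bop"
    obtain h k where "a = h + \<i> *\<^sub>C k" "adj h = h" "adj k = k" using bop_cartesian by blast
    then show "(\<Phi> \<circ> \<Theta>) a = (\<Theta> \<circ> \<Phi>) a"
      using lin by (simp add: complex_linear_map_def selfadjoint_case)
  qed
qed

section \<open>Von Neumann algebras and their unitary elements\<close>

text \<open>Makes the hull in \<open>region_algebra\<close> a von Neumann algebra: the bicommutant
  is monotone, so that of the intersection lies in every member.\<close>

lemma von_neumann_algebra_Inter:
  assumes "\<And>M. M \<in> \<M> \<Longrightarrow> von_neumann_algebra M"
  shows "von_neumann_algebra (\<Inter>\<M>)"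
  unfolding von_neumann_algebra_def
proof
  show "\<forall>a\<in>\<Inter>\<M>. adj a \<in> \<Inter>\<M>" using assms by (auto simp: von_neumann_algebra_def)
  have "commutant (commutant (\<Inter>\<M>)) \<subseteq> M" if "M \<in> \<M>" for M
  proof -
    have "commutant (commutant (\<Inter>\<M>)) \<subseteq> commutant (commutant M)"
      using that by (auto simp: commutant_def)
    then show ?thesis using assms[OF that] by (simp add: von_neumann_algebra_def)
  qed
  moreover have "\<Inter>\<M> \<subseteq> commutant (commutant (\<Inter>\<M>))" by (auto simp: commutant_def)
  ultimately show "commutant (commutant (\<Inter>\<M>)) = \<Inter>\<M>" by blast
qed

lemma von_neumann_algebra_region: "von_neumann_algebra (region_algebra A R)"
  unfolding region_algebra_def by (rule hull_in) (rule von_neumann_algebra_Inter, blast)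

lemma adj_in_commutant:
  assumes "\<And>a. a \<in> N \<Longrightarrow> adj a \<in> N" "a \<in> commutant N"
  shows "adj a \<in> commutant N"
  unfolding commutant_def
proof (intro CollectI ballI)
  fix b assume "b \<in> N"
  then have "a * adj b = adj b * a" using assms by (simp add: commutant_def)
  then have "adj (a * adj b) = adj (adj b * a)" by simp
  then show "adj a * b = b * adj a" by (simp add: adj_mult)
qed

text \<open>Normality holds because \<open>Ad u\<close> has the order-preserving inverse
  \<open>x \<mapsto> u * x * adj u\<close> and hence preserves every supremum.\<close>

lemma normal_ucp_Ad:
  assumes "unitary u" shows "normal_ucp (Ad u)"
proof -
  have u: "adj u * u = 1" "u * adj u = 1" using assms by (simp_all add: unitary_def)
  have inv: "u * Ad u x * adj u = x" "Ad u (u * x * adj u) = x" for x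
    unfolding Ad_def by (metis u mult.assoc mult_1_left mult_1_right)+
  have lin: "complex_linear_map (Ad u)"
    by (simp add: complex_linear_map_def Ad_def algebra_simps scaleC_bop_mult_left scaleC_bop_mult_right)
  have "positive_matrix n (\<lambda>i j. Ad u (X i j))" if "positive_matrix n X" for n X
    using that unfolding positive_matrix_def Ad_def
    by (simp add: bop_rep_eqs cinner_adj_right)
  then have cp: "completely_positive (Ad u)" using lin by (simp add: completely_positive_def)
  have lub: "isLub UNIV (Ad u ` D) (Ad u x)" if D: "isLub UNIV D x" for D x
  proof (rule isLub_UNIV_image_I)
    have ub: "a \<le> x" if "a \<in> D" for a using D that by (auto simp: isLub_def leastP_def isUb_def setle_def)
    show "Ad u a \<le> Ad u x" if "a \<in> D" for a
      by (rule monoD[OF completely_positive_mono[OF cp] ub[OF that]])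
    fix b assume b: "\<And>a. a \<in> D \<Longrightarrow> Ad u a \<le> b"
    have sandwich_mono: "u * y * adj u \<le> u * z * adj u" if "y \<le> z" for y z
      using sandwich_nonneg[of "z - y" u] that by (simp add: algebra_simps)
    have "isLub UNIV (id ` D) x" using D by simp
    then have "x \<le> u * b * adj u"
    proof (rule isLub_UNIV_image_least)
      show "id a \<le> u * b * adj u" if "a \<in> D" for a
        using sandwich_mono[OF b[OF that]] by (simp add: inv)
    qed
    then have "Ad u x \<le> Ad u (u * b * adj u)" by (rule monoD[OF completely_positive_mono[OF cp]])
    then show "Ad u x \<le> b" by (simp add: inv)
  qed
  have "normal_map (Ad u)" unfolding normal_map_def using lub by blast
  then show ?thesis using cp u by (simp add: normal_ucp_def Ad_def)
qed

section \<open>Unitary channels, phases and Cayley transforms\<close>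

text \<open>The operators \<open>rank1 x e\<close> with one fixed \<open>e \<noteq> 0\<close>
  suffice as tests: evaluating both products at \<open>e\<close> shows that \<open>T\<close>
  multiplies every \<open>x\<close> by the same number.\<close>

lemma central_is_scalar:
  fixes T :: "'h::complex_hilbert_space bop"
  assumes "\<And>x. T * x = x * T"
  obtains c where "T = c *\<^sub>C 1"
proof (cases "\<exists>e :: 'h. e \<noteq> 0")
  case True
  then obtain e :: 'h where e: "e \<noteq> 0" by blast
  define c where "c = cinner e (bop_apply T e) / cinner e e"
  have "bop_apply T x = bop_apply (c *\<^sub>C 1) x" for x
  proof -
    have "bop_apply (T * rank1 x e) e = bop_apply (rank1 x e * T) e" by (simp add: assms)
    then have "cinner e e *\<^sub>C bop_apply T x = cinner e (bop_apply T e) *\<^sub>C x"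
      by (simp add: bop_rep_eqs rank1.rep_eq bop_apply_scaleC)
    then have "(1 / cinner e e) *\<^sub>C cinner e e *\<^sub>C bop_apply T x
        = (1 / cinner e e) *\<^sub>C cinner e (bop_apply T e) *\<^sub>C x" by simp
    then show ?thesis using e by (simp add: scaleC_scaleC cinner_self c_def bop_rep_eqs)
  qed
  then show ?thesis using that bop_eqI by blast
next
  case False
  then have "T = 0 *\<^sub>C 1" by (intro bop_eqI) metis
  then show ?thesis using that by blast
qed

text \<open>\<open>Ad u \<circ> Ad v\<close> is \<open>Ad (v * u)\<close>, so \<open>v * u\<close>
  and \<open>u * v\<close> implement the same automorphism and differ by a central factor.\<close>

lemma Ad_commute_phase:
  assumes u: "unitary u" and v: "unitary v" and comm: "Ad u \<circ> Ad v = Ad v \<circ> Ad u"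
  obtains c where "u * v = c *\<^sub>C (v * u)"
proof -
  have uv: "adj u * u = 1" "u * adj u = 1" "adj v * v = 1" "v * adj v = 1"
    using u v by (simp_all add: unitary_def)
  define a where "a = v * u"
  define b where "b = u * v"
  have a: "adj a * a = 1" "a * adj a = 1" and b: "adj b * b = 1" "b * adj b = 1"
    unfolding a_def b_def adj_mult by (metis uv mult.assoc mult_1_left)+
  have ab: "adj a * x * a = adj b * x * b" for x
    using fun_cong[OF comm, of x] by (simp add: Ad_def a_def b_def adj_mult mult.assoc)
  have "(b * adj a) * x = x * (b * adj a)" for x
  proof -
    have "(b * adj a) * x = b * (adj a * x * a) * adj a" by (metis a(2) mult.assoc mult_1_right)
    also have "\<dots> = x * (b * adj a)" unfolding ab by (metis b(2) mult.assoc mult_1_left)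
    finally show ?thesis .
  qed
  then obtain c where "b * adj a = c *\<^sub>C 1" by (rule central_is_scalar)
  then have "b * adj a * a = c *\<^sub>C a" by (simp add: scaleC_bop_mult_left)
  then have "b = c *\<^sub>C a" by (simp add: mult.assoc a)
  then show ?thesis using that by (simp add: a_def b_def)
qed

lemma norm_unitary:
  assumes "unitary u" shows "norm (bop_apply u x) = norm x"
proof -
  have "bop_apply (adj u) (bop_apply u x) = x"
    using assms by (metis unitary_def times_bop.rep_eq one_bop.rep_eq)
  then have "cinner (bop_apply u x) (bop_apply u x) = cinner x x" by (metis cinner_adj)
  then have "(norm (bop_apply u x))\<^sup>2 = (norm x)\<^sup>2" by (simp only: cinner_self of_real_eq_iff)
  then show ?thesis by (simp add: power2_eq_iff_nonneg)
qed

text \<open>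
  Since \<open>v\<close> conjugates \<open>u\<close> into \<open>c u\<close>, all of the numbers \<open>c\<^sup>n \<langle>x, u x\<rangle>\<close> lie in the numerical range of
  \<open>u\<close>, a set in a half plane away from \<open>0\<close>; for \<open>c \<noteq> 1\<close> their sums would be bounded.
\<close>
lemma phase_trivial:
  fixes u v :: "'h::complex_hilbert_space bop"
  assumes u: "unitary u" and v: "unitary v" and uv: "u * v = c *\<^sub>C (v * u)"
    and \<delta>: "\<delta> > 0" "\<And>x. \<delta> * (norm x)\<^sup>2 \<le> ev x u"
  shows "u * v = v * u"
proof (cases "\<exists>x :: 'h. x \<noteq> 0")
  case True
  then obtain x :: 'h where x: "x \<noteq> 0" by blast
  have "norm (bop_apply (u * v) x) = cmod c * norm (bop_apply (v * u) x)"
    by (simp add: uv scaleC_bop.rep_eq norm_scaleC)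
  then have c: "cmod c = 1" using x by (simp add: times_bop.rep_eq norm_unitary[OF u] norm_unitary[OF v])
  have pw: "u * v ^ n = c ^ n *\<^sub>C (v ^ n * u)" for n
  proof (induction n)
    case (Suc n)
    have "u * v ^ Suc n = (u * v) * v ^ n" by (simp add: mult.assoc)
    also have "\<dots> = c *\<^sub>C (v * (u * v ^ n))" by (simp add: uv scaleC_bop_mult_left mult.assoc)
    also have "\<dots> = c ^ Suc n *\<^sub>C (v ^ Suc n * u)"
      by (simp add: Suc scaleC_bop_mult_right scaleC_scaleC mult.assoc)
    finally show ?case .
  qed simp
  have vn: "adj (v ^ n) * v ^ n = 1" for n
  proof (induction n)
    case (Suc n)
    have "adj (v ^ Suc n) * v ^ Suc n = adj (v ^ n) * (adj v * v) * v ^ n" by (simp add: adj_mult mult.assoc)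
    then show ?case using v Suc by (simp add: unitary_def)
  qed simp
  then have vn': "cinner (bop_apply (v ^ n) y) (bop_apply (v ^ n) z) = cinner y z" for n y z
    by (metis cinner_adj_right times_bop.rep_eq one_bop.rep_eq)
  define z where "z = cinner x (bop_apply u x)"
  have "\<delta> * (norm x)\<^sup>2 \<le> Re (c ^ n * z)" for n
  proof -
    let ?y = "bop_apply (v ^ n) x"
    have "(norm ?y)\<^sup>2 = (norm x)\<^sup>2"
      using vn'[of n x x] by (simp only: cinner_self of_real_eq_iff)
    moreover have "cinner ?y (bop_apply u ?y) = c ^ n * z"
    proof -
      have "bop_apply u ?y = c ^ n *\<^sub>C bop_apply (v ^ n) (bop_apply u x)"
        by (metis pw times_bop.rep_eq scaleC_bop.rep_eq)
      then show ?thesis by (simp add: cinner_scaleC_right vn' z_def)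
    qed
    ultimately show ?thesis using \<delta>(2)[of ?y] by (simp add: ev_def)
  qed
  then have "(\<Sum>n<m. \<delta> * (norm x)\<^sup>2) \<le> (\<Sum>n<m. Re (c ^ n * z))" for m
    by (intro sum_mono)
  then have lower: "real m * (\<delta> * (norm x)\<^sup>2) \<le> Re ((\<Sum>n<m. c ^ n) * z)" for m
    by (simp add: sum_distrib_right)
  have "c = 1"
  proof (rule ccontr)
    assume n: "c \<noteq> 1"
    define b where "b = 2 * cmod z / cmod (1 - c)"
    have "Re ((\<Sum>n<m. c ^ n) * z) \<le> b" for m
    proof -
      have "(\<Sum>n<m. c ^ n) * z = (1 - c ^ m) * z / (1 - c)"
        using n by (simp add: geometric_sum field_simps)
      then have "Re ((\<Sum>n<m. c ^ n) * z) \<le> cmod ((1 - c ^ m) * z / (1 - c))"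
        by (metis complex_Re_le_cmod)
      also have "\<dots> = cmod (1 - c ^ m) * cmod z / cmod (1 - c)" by (simp add: norm_mult norm_divide)
      also have "\<dots> \<le> b"
        unfolding b_def using norm_triangle_ineq4[of 1 "c ^ m"] c
        by (intro divide_right_mono mult_right_mono) (simp_all add: norm_power)
      finally show ?thesis .
    qed
    moreover have "\<delta> * (norm x)\<^sup>2 > 0" using \<delta> x by simp
    then obtain m where "b < real m * (\<delta> * (norm x)\<^sup>2)" using reals_Archimedean3 by blast
    ultimately show False using lower[of m] by (meson not_le order_trans)
  qed
  then show ?thesis by (simp add: uv)
next
  case False
  then show ?thesis by (intro bop_eqI) metis
qed

text \<open>The Cayley transform \<open>u = (1 + i h) (1 - i h)\<^sup>-\<^sup>1 = 2 (1 - i h)\<^sup>-\<^sup>1 - 1\<close>.\<close>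
lemma cayley:
  fixes h :: "'h::complex_hilbert_space bop"
  assumes h: "adj h = h" "\<And>x. norm (bop_apply h x) \<le> norm x / 2"
  obtains u where "unitary u" "\<And>a. a * u = u * a \<longleftrightarrow> a * h = h * a"
    "\<And>x. (1 / 3) * (norm x)\<^sup>2 \<le> ev x u"
proof -
  let ?k = "\<i> *\<^sub>C h"
  have k: "adj ?k = - ?k"
    using scaleC_add_left[of \<i> "- \<i>" h] by (simp add: adj_scaleC h eq_neg_iff_add_eq_0 add.commute)
  have k_le: "norm (bop_apply ?k x) \<le> norm x / 2" for x
    using h(2)[of x] by (simp add: bop_rep_eqs norm_scaleC)
  \<comment> \<open>Solving \<open>(1 - ?k) x = y\<close> is the fixed point problem of
    \<open>x \<mapsto> y + ?k x\<close>, a contraction by the bound \<open>1 / 2\<close> on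
    \<open>h\<close>.\<close>
  have "\<exists>!x. y + bop_apply ?k x = x" for y
  proof (rule banach_fix_type[of "1 / 2"])
    show "\<forall>x x'. dist (y + bop_apply ?k x) (y + bop_apply ?k x') \<le> 1 / 2 * dist x x'"
      using k_le by (simp add: dist_norm flip: bop_apply_diff)
  qed simp_all
  then have "\<exists>!x. bop_apply (1 - ?k) x = y" for y
    by (simp add: minus_bop.rep_eq one_bop.rep_eq diff_eq_eq eq_commute[of _ "y + _"])
  then obtain g where g: "\<And>y. bop_apply (1 - ?k) (g y) = y"
    and g_unique: "\<And>x y. bop_apply (1 - ?k) x = y \<Longrightarrow> x = g y" by metis
  have "norm (g y) \<le> norm y * 2" for y
  proof -
    have "g y = y + bop_apply ?k (g y)"
      using g[of y] by (simp add: minus_bop.rep_eq one_bop.rep_eq diff_eq_eq)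
    then have "norm (g y) \<le> norm y + norm (bop_apply ?k (g y))" by (metis norm_triangle_ineq)
    then show ?thesis using k_le[of "g y"] by simp
  qed
  moreover have "g (y + z) = g y + g z" for y z
    by (rule g_unique[symmetric]) (simp only: bop_apply_add g)
  moreover have g_scale: "g (c *\<^sub>C y) = c *\<^sub>C g y" for c y
    by (rule g_unique[symmetric]) (simp only: bop_apply_scaleC g)
  ultimately have "bounded_linear g"
    by (intro bounded_linear_intro[where K = 2]) (simp_all add: scaleR_scaleC)
  define G where "G = Bop g"
  have G: "bop_apply G y = g y" for y
    using \<open>bounded_linear g\<close> g_scale by (simp add: G_def Bop_inverse)
  have kG: "(1 - ?k) * G = 1" by (rule bop_eqI) (simp add: times_bop.rep_eq one_bop.rep_eq G g)
  have Gk: "G * (1 - ?k) = 1"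
    by (rule bop_eqI) (simp add: times_bop.rep_eq one_bop.rep_eq G flip: g_unique)
  define u where "u = (1 + ?k) * G"
  have u_k: "u * (1 - ?k) = 1 + ?k" by (simp add: u_def mult.assoc Gk)
  have u_G: "u = G + G - 1"
  proof -
    have "1 + ?k = 1 + 1 - (1 - ?k)" by simp
    then have "u = (1 + 1 - (1 - ?k)) * G" by (simp only: u_def)
    also have "\<dots> = G + G - (1 - ?k) * G" by (simp only: left_diff_distrib distrib_right mult_1_left)
    finally show ?thesis by (simp only: kG)
  qed
  have adjs: "adj (1 - ?k) = 1 + ?k" "adj (1 + ?k) = 1 - ?k"
    unfolding adj_diff adj_add k by simp_all
  have adjG: "adj G * (1 + ?k) = 1" "(1 + ?k) * adj G = 1"
    using arg_cong[OF kG, of adj] arg_cong[OF Gk, of adj] by (simp_all add: adj_mult adjs)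
  have adju: "adj u = adj G * (1 - ?k)" by (simp add: u_def adj_mult adjs)
  have comm: "(1 - ?k) * (1 + ?k) = (1 + ?k) * (1 - ?k)" by (simp add: algebra_simps)
  have "adj u * u = 1"
  proof -
    have "adj u * u = adj G * ((1 - ?k) * (1 + ?k)) * G"
      unfolding adju by (simp only: u_def mult.assoc)
    also have "\<dots> = (adj G * (1 + ?k)) * ((1 - ?k) * G)" by (simp only: comm mult.assoc)
    finally show ?thesis by (simp only: adjG kG mult_1_left)
  qed
  moreover have "u * adj u = 1"
  proof -
    have "G * (1 + ?k) = G * (1 + ?k) * ((1 - ?k) * G)" by (simp only: kG mult_1_right)
    also have "\<dots> = G * ((1 - ?k) * (1 + ?k)) * G" by (simp only: comm mult.assoc)
    also have "\<dots> = (G * (1 - ?k)) * ((1 + ?k) * G)" by (simp only: mult.assoc)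
    finally have "u = G * (1 + ?k)" by (simp only: Gk mult_1_left u_def)
    then have "u * adj u = G * ((1 + ?k) * adj G) * (1 - ?k)"
      unfolding adju by (simp only: mult.assoc)
    then show ?thesis by (simp only: adjG Gk mult_1_right)
  qed
  ultimately have "unitary u" by (simp add: unitary_def)
  \<comment> \<open>Since \<open>u = G + G - 1\<close> and \<open>G\<close> inverts
    \<open>1 - ?k\<close>, the operators \<open>u\<close>, \<open>G\<close> and \<open>h\<close>
    commute with the same operators. One direction places \<open>u\<close> in every commutant that
    contains \<open>h\<close>, the other returns from \<open>u\<close> to \<open>h\<close>.\<close>
  moreover have "a * u = u * a \<longleftrightarrow> a * h = h * a" for a
  proof
    assume "a * u = u * a"
    then have "(a * G - G * a) + (a * G - G * a) = 0" by (simp add: u_G algebra_simps)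
    then have "2 *\<^sub>R (a * G - G * a) = 0" by (simp only: scaleR_2)
    then have aG: "a * G = G * a" by simp
    have "(1 - ?k) * a = (1 - ?k) * (a * G) * (1 - ?k)" by (simp only: mult.assoc Gk mult_1_right)
    also have "\<dots> = ((1 - ?k) * G) * a * (1 - ?k)" by (simp only: aG mult.assoc)
    finally have "(1 - ?k) * a = a * (1 - ?k)" by (simp only: kG mult_1_left)
    then have "?k * a = a * ?k" by (simp add: left_diff_distrib right_diff_distrib)
    then have "- \<i> *\<^sub>C \<i> *\<^sub>C (h * a) = - \<i> *\<^sub>C \<i> *\<^sub>C (a * h)"
      by (simp only: scaleC_bop_mult_left scaleC_bop_mult_right)
    then show "a * h = h * a" by (simp add: scaleC_scaleC)
  next
    assume "a * h = h * a"
    then have "a * (1 - ?k) = (1 - ?k) * a"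
      by (simp add: algebra_simps scaleC_bop_mult_left scaleC_bop_mult_right)
    then have "G * (a * (1 - ?k)) * G = G * ((1 - ?k) * a) * G" by simp
    then have "(G * a) * ((1 - ?k) * G) = (G * (1 - ?k)) * (a * G)" by (simp only: mult.assoc)
    then have "G * a = a * G" by (simp only: kG Gk mult_1_left mult_1_right)
    then show "a * u = u * a" by (simp add: u_G algebra_simps)
  qed
  \<comment> \<open>With \<open>y = g x\<close> the vectors \<open>x\<close> and \<open>u x\<close>
    are \<open>y - ?k y\<close> and \<open>y + ?k y\<close>. The real cross terms cancel, so the
    expectation is at least \<open>3/4\<close> of the squared norm of \<open>y\<close>, while
    \<open>norm x\<close> is at most \<open>3/2\<close> of \<open>norm y\<close>. The constant is
    \<open>(3/4) * (4/9) = 1/3\<close>.\<close>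
  moreover have "(1 / 3) * (norm x)\<^sup>2 \<le> ev x u" for x
  proof -
    let ?ky = "bop_apply ?k (g x)"
    have x: "x = g x - ?ky" using g[of x] by (simp add: minus_bop.rep_eq one_bop.rep_eq)
    have ux: "bop_apply u x = g x + ?ky"
      by (simp add: u_def times_bop.rep_eq plus_bop.rep_eq one_bop.rep_eq G)
    have "ev x u = inner (g x - ?ky) (g x + ?ky)"
      unfolding ev_def ux inner_eq_Re_cinner by (subst x) (rule refl)
    also have "\<dots> = (norm (g x))\<^sup>2 - (norm ?ky)\<^sup>2"
      by (simp add: power2_norm_eq_inner inner_diff_left inner_diff_right inner_add_right inner_commute)
    finally have ev: "ev x u = (norm (g x))\<^sup>2 - (norm ?ky)\<^sup>2" .
    have "(norm ?ky)\<^sup>2 \<le> (norm (g x) / 2)\<^sup>2" by (rule power_mono[OF k_le]) simp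
    moreover have "norm x \<le> norm (g x) * (3 / 2)"
      using norm_triangle_ineq4[of "g x" ?ky] k_le[of "g x"] x by simp
    then have "(norm x)\<^sup>2 \<le> (norm (g x) * (3 / 2))\<^sup>2" by (rule power_mono) simp
    ultimately show ?thesis by (simp add: ev power_mult_distrib power_divide)
  qed
  ultimately show ?thesis using that by blast
qed

section \<open>Closure properties of commutants, module maps and commuting commutants\<close>

lemma adj_in_von_neumann_algebra: "von_neumann_algebra N \<Longrightarrow> a \<in> N \<Longrightarrow> adj a \<in> N"
  by (simp add: von_neumann_algebra_def)

lemma bicommutant_von_neumann_algebra: "von_neumann_algebra N \<Longrightarrow> commutant (commutant N) = N"
  by (simp add: von_neumann_algebra_def)

lemma mult_in_commutant:
  assumes "a \<in> commutant N" "b \<in> commutant N" shows "a * b \<in> commutant N"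
  unfolding commutant_def
proof (intro CollectI ballI)
  fix c assume "c \<in> N"
  then have "a * c = c * a" "b * c = c * b" using assms by (simp_all add: commutant_def)
  then show "a * b * c = c * (a * b)" by (metis mult.assoc)
qed

lemma add_in_commutant: "a \<in> commutant N \<Longrightarrow> b \<in> commutant N \<Longrightarrow> a + b \<in> commutant N"
  by (simp add: commutant_def algebra_simps)

lemma diff_in_commutant: "a \<in> commutant N \<Longrightarrow> b \<in> commutant N \<Longrightarrow> a - b \<in> commutant N"
  by (simp add: commutant_def algebra_simps)

lemma scaleC_in_commutant: "a \<in> commutant N \<Longrightarrow> c *\<^sub>C a \<in> commutant N"
  by (simp add: commutant_def scaleC_bop_mult_left scaleC_bop_mult_right)

lemma commutant_transfer:
  assumes "\<And>a. a * u = u * a \<longleftrightarrow> a * h = h * a" "h \<in> commutant N"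
  shows "u \<in> commutant N"
  unfolding commutant_def
proof (intro CollectI ballI)
  fix b assume "b \<in> N"
  then have "b * h = h * b" using assms(2) by (simp add: commutant_def)
  then show "u * b = b * u" using assms(1)[of b] by simp
qed

text \<open>Being a bicommutant, \<open>N\<close> is closed under products, so \<open>y\<close>, its
  adjoint and their products are all fixed and \<open>multiplicative_domain\<close> applies on both
  sides.\<close>

lemma von_neumann_algebra_module_map:
  assumes N: "von_neumann_algebra N" and \<Phi>: "normal_ucp \<Phi>"
    and fixed: "\<forall>y\<in>N. \<Phi> y = y" and y: "y \<in> N"
  shows "\<Phi> (y * x) = y * \<Phi> x" "\<Phi> (x * y) = \<Phi> x * y"
proof -
  note adj = adj_in_von_neumann_algebra[OF N]
  have mult: "a * b \<in> N" if "a \<in> N" "b \<in> N" for a b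
    using mult_in_commutant[of a "commutant N" b] that bicommutant_von_neumann_algebra[OF N] by simp
  have \<Phi>': "completely_positive \<Phi>" "\<Phi> 1 = 1" using \<Phi> by (simp_all add: normal_ucp_def)
  show "\<Phi> (y * x) = y * \<Phi> x"
    using multiplicative_domain(1)[OF \<Phi>', of "adj y" x] y by (simp add: fixed adj mult)
  show "\<Phi> (x * y) = \<Phi> x * y"
    using multiplicative_domain(2)[OF \<Phi>', of y "adj x"] y by (simp add: fixed adj mult)
qed

text \<open>Commutants of adjoint-closed sets are spanned by their self-adjoint elements, and
  scaling makes these small enough for \<open>cayley\<close>. The resulting unitaries stay in the
  commutants, so the hypothesis on channels applies to them.\<close>

lemma commuting_sets_commutantI:
  fixes N\<^sub>1 N\<^sub>2 :: "'h::complex_hilbert_space bop set"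
  assumes adj1: "\<And>a. a \<in> N\<^sub>1 \<Longrightarrow> adj a \<in> N\<^sub>1" and adj2: "\<And>a. a \<in> N\<^sub>2 \<Longrightarrow> adj a \<in> N\<^sub>2"
    and Ad: "\<And>u v. unitary u \<Longrightarrow> unitary v \<Longrightarrow> u \<in> commutant N\<^sub>1 \<Longrightarrow> v \<in> commutant N\<^sub>2 \<Longrightarrow>
      Ad u \<circ> Ad v = Ad v \<circ> Ad u"
  shows "commuting_sets (commutant N\<^sub>1) (commutant N\<^sub>2)"
proof -
  have small: "h * k = k * h" if h: "h \<in> commutant N\<^sub>1" "adj h = h" "\<And>x. norm (bop_apply h x) \<le> norm x / 2"
    and k: "k \<in> commutant N\<^sub>2" "adj k = k" "\<And>x. norm (bop_apply k x) \<le> norm x / 2" for h k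
  proof -
    obtain u where u: "unitary u" "\<And>a. a * u = u * a \<longleftrightarrow> a * h = h * a"
      "\<And>x. (1 / 3) * (norm x)\<^sup>2 \<le> ev x u" by (rule cayley[OF h(2,3)]) (rule that; assumption)
    obtain v where v: "unitary v" "\<And>a. a * v = v * a \<longleftrightarrow> a * k = k * a"
      "\<And>x. (1 / 3) * (norm x)\<^sup>2 \<le> ev x v" by (rule cayley[OF k(2,3)]) (rule that; assumption)
    have "u \<in> commutant N\<^sub>1" "v \<in> commutant N\<^sub>2"
      by (rule commutant_transfer[OF u(2) h(1)], rule commutant_transfer[OF v(2) k(1)])
    then have "Ad u \<circ> Ad v = Ad v \<circ> Ad u" by (intro Ad u v)
    then obtain c where "u * v = c *\<^sub>C (v * u)" by (rule Ad_commute_phase[OF u(1) v(1)])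
    then have "u * v = v * u" using u(3) by (intro phase_trivial[OF u(1) v(1), where \<delta> = "1 / 3"]) simp_all
    \<comment> \<open>The Cayley equivalence is used once on each side: from \<open>u\<close> to
      \<open>h\<close> with \<open>a = v\<close>, then from \<open>v\<close> to \<open>k\<close>
      with \<open>a = h\<close>.\<close>
    then have "v * h = h * v" using u(2)[of v] by simp
    then show ?thesis using v(2)[of h] by simp
  qed
  have shrink: "\<exists>r>0. \<forall>x. norm (bop_apply (complex_of_real r *\<^sub>C h) x) \<le> norm x / 2" for h :: "'h bop"
  proof -
    obtain K where K: "K > 0" "\<And>x. norm (bop_apply h x) \<le> K * norm x" using bop_bounded by blast
    have "norm (bop_apply (complex_of_real (1 / (2 * K)) *\<^sub>C h) x) \<le> norm x / 2" for x
      using K by (simp add: scaleC_bop.rep_eq norm_scaleC norm_divide field_simps)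
    then show ?thesis using K(1) by (intro exI[of _ "1 / (2 * K)"]) simp
  qed
  have selfadj: "h * k = k * h" if h: "h \<in> commutant N\<^sub>1" "adj h = h" and k: "k \<in> commutant N\<^sub>2" "adj k = k" for h k
  proof -
    obtain r where r: "r > 0" "\<And>x. norm (bop_apply (complex_of_real r *\<^sub>C h) x) \<le> norm x / 2"
      using shrink by blast
    obtain s where s: "s > 0" "\<And>x. norm (bop_apply (complex_of_real s *\<^sub>C k) x) \<le> norm x / 2"
      using shrink by blast
    have "(complex_of_real r *\<^sub>C h) * (complex_of_real s *\<^sub>C k)
        = (complex_of_real s *\<^sub>C k) * (complex_of_real r *\<^sub>C h)"
      using h k r(2) s(2) by (intro small scaleC_in_commutant) (simp_all add: adj_scaleC)
    then have "(r * s) *\<^sub>R (h * k) = (r * s) *\<^sub>R (k * h)"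
      by (simp add: scaleC_bop_mult_left scaleC_bop_mult_right scaleC_scaleC scaleR_scaleC mult.commute)
    then show ?thesis using r(1) s(1) by simp
  qed
  have "a * b = b * a" if a: "a \<in> commutant N\<^sub>1" and b: "b \<in> commutant N\<^sub>2" for a b
  proof -
    obtain h k where hk: "a = h + \<i> *\<^sub>C k" "adj h = h" "adj k = k"
      "h = (1/2) *\<^sub>C (a + adj a)" "k = (- \<i> / 2) *\<^sub>C (a - adj a)" by (rule bop_cartesian)
    obtain h' k' where hk': "b = h' + \<i> *\<^sub>C k'" "adj h' = h'" "adj k' = k'"
      "h' = (1/2) *\<^sub>C (b + adj b)" "k' = (- \<i> / 2) *\<^sub>C (b - adj b)" by (rule bop_cartesian)
    have "h \<in> commutant N\<^sub>1" "k \<in> commutant N\<^sub>1" "h' \<in> commutant N\<^sub>2" "k' \<in> commutant N\<^sub>2"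
      unfolding hk(4,5) hk'(4,5)
      by (intro scaleC_in_commutant add_in_commutant diff_in_commutant a b
          adj_in_commutant[OF adj1 a] adj_in_commutant[OF adj2 b]; assumption)+
    note sa = selfadj[OF this(1) hk(2) this(3) hk'(2)] selfadj[OF this(1) hk(2) this(4) hk'(3)]
      selfadj[OF this(2) hk(3) this(3) hk'(2)] selfadj[OF this(2) hk(3) this(4) hk'(3)]
    show ?thesis
      unfolding hk(1) hk'(1)
      by (simp add: sa distrib_left distrib_right scaleC_bop_mult_left scaleC_bop_mult_right
          scaleC_add_right add_ac)
  qed
  then show ?thesis unfolding commuting_sets_def by blast
qed

theorem theorem4p3:
  fixes A :: "('s::euclidean_space, 'h::complex_hilbert_space) net"
  assumes "haag_kastler_net A"
  shows "(essential_duality A \<longleftrightarrow> spacelike_order_independent (NS A)) \<and>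
    (spacelike_order_independent (NS A) \<longleftrightarrow>
      (\<forall>K\<^sub>1 K\<^sub>2. spacelike_pair K\<^sub>1 K\<^sub>2 \<longrightarrow>
        (\<forall>\<Phi>\<^sub>1 \<in> NS A K\<^sub>1 \<inter> unitary_channels. \<forall>\<Phi>\<^sub>2 \<in> NS A K\<^sub>2 \<inter> unitary_channels.
          \<Phi>\<^sub>1 \<circ> \<Phi>\<^sub>2 = \<Phi>\<^sub>2 \<circ> \<Phi>\<^sub>1)))"
proof -
  let ?N = "\<lambda>K. region_algebra A (causal_complement K)"
  let ?iii = "\<forall>K\<^sub>1 K\<^sub>2. spacelike_pair K\<^sub>1 K\<^sub>2 \<longrightarrow>
    (\<forall>\<Phi>\<^sub>1 \<in> NS A K\<^sub>1 \<inter> unitary_channels. \<forall>\<Phi>\<^sub>2 \<in> NS A K\<^sub>2 \<inter> unitary_channels.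
      \<Phi>\<^sub>1 \<circ> \<Phi>\<^sub>2 = \<Phi>\<^sub>2 \<circ> \<Phi>\<^sub>1)"
  have vna: "von_neumann_algebra (?N K)" for K by (rule von_neumann_algebra_region)
  have "\<Phi>\<^sub>1 \<circ> \<Phi>\<^sub>2 = \<Phi>\<^sub>2 \<circ> \<Phi>\<^sub>1" if dual: "essential_duality A" and pair: "spacelike_pair K\<^sub>1 K\<^sub>2"
    and \<Phi>: "\<Phi>\<^sub>1 \<in> NS A K\<^sub>1" "\<Phi>\<^sub>2 \<in> NS A K\<^sub>2" for K\<^sub>1 K\<^sub>2 \<Phi>\<^sub>1 \<Phi>\<^sub>2
  proof (rule normal_ucp_module_commute[where N = "?N K\<^sub>1"])
    show ucp: "normal_ucp \<Phi>\<^sub>1" "normal_ucp \<Phi>\<^sub>2" using \<Phi> by (simp_all add: NS_def)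
    have fixed: "\<forall>y\<in>?N K\<^sub>1. \<Phi>\<^sub>1 y = y" "\<forall>y\<in>?N K\<^sub>2. \<Phi>\<^sub>2 y = y" using \<Phi> by (simp_all add: NS_def)
    show "\<Phi>\<^sub>1 (y * x) = y * \<Phi>\<^sub>1 x" if "y \<in> ?N K\<^sub>1" for x y
      by (rule von_neumann_algebra_module_map(1)[OF vna ucp(1) fixed(1) that])
    show "\<Phi>\<^sub>2 (d * x * adj d) = d * \<Phi>\<^sub>2 x * adj d" if d: "d \<in> commutant (?N K\<^sub>1)" for x d
    proof -
      \<comment> \<open>\<open>d\<close> lies in the dual algebra of \<open>K\<^sub>1\<close>, so
        duality makes it commute with that of \<open>K\<^sub>2\<close>, which is
        \<open>commutant (?N K\<^sub>2)\<close>. By the bicommutant property \<open>d\<close>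
        belongs to the algebra that \<open>\<Phi>\<^sub>2\<close> fixes.\<close>
      have "d \<in> commutant (commutant (?N K\<^sub>2))"
        using dual pair d unfolding essential_duality_def commuting_sets_def dual_net_def
        by (simp add: commutant_def[of "commutant _"])
      then have d2: "d \<in> ?N K\<^sub>2" by (simp only: bicommutant_von_neumann_algebra[OF vna])
      note module = von_neumann_algebra_module_map[OF vna ucp(2) fixed(2)]
      show ?thesis
        by (simp only: module(2)[OF adj_in_von_neumann_algebra[OF vna d2]] module(1)[OF d2])
    qed
  qed
  then have "spacelike_order_independent (NS A)" if "essential_duality A"
    using that unfolding spacelike_order_independent_def by blast
  moreover have ?iii if "spacelike_order_independent (NS A)"
    using that unfolding spacelike_order_independent_def by blast
  moreover have "essential_duality A" if iii: ?iii
    unfolding essential_duality_def dual_net_def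
  proof (intro allI impI)
    fix K\<^sub>1 K\<^sub>2 :: "'s minkowski set"
    assume pair: "spacelike_pair K\<^sub>1 K\<^sub>2"
    have channel: "Ad u \<in> NS A K \<inter> unitary_channels" if u: "unitary u" "u \<in> commutant (?N K)" for u K
    proof -
      have "Ad u y = y" if "y \<in> ?N K" for y
      proof -
        have "Ad u y = adj u * (y * u)" by (simp add: Ad_def mult.assoc)
        also have "\<dots> = adj u * u * y" using u(2) that by (simp add: commutant_def mult.assoc)
        finally show ?thesis using u(1) by (simp add: unitary_def)
      qed
      then show ?thesis using u(1) by (auto simp: NS_def normal_ucp_Ad unitary_channels_def)
    qed
    show "commuting_sets (commutant (?N K\<^sub>1)) (commutant (?N K\<^sub>2))"
    proof (rule commuting_sets_commutantI)
      show "adj a \<in> ?N K\<^sub>1" if "a \<in> ?N K\<^sub>1" for a by (rule adj_in_von_neumann_algebra[OF vna that])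
      show "adj a \<in> ?N K\<^sub>2" if "a \<in> ?N K\<^sub>2" for a by (rule adj_in_von_neumann_algebra[OF vna that])
      show "Ad u \<circ> Ad v = Ad v \<circ> Ad u" if "unitary u" "unitary v" "u \<in> commutant (?N K\<^sub>1)"
        "v \<in> commutant (?N K\<^sub>2)" for u v
        by (rule iii[rule_format, OF pair channel channel]) (fact that)+
    qed
  qed
  ultimately show ?thesis by blast
qed

end
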